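(* There exists a (deterministic) fully dynamic graph algorithm which maintains a maximal matching of an undirected graph on $n$ vertices, using a lookahead of length $m$, with amortized update cost $O(\log m)$, with constant (that is, $O(1)$) query cost for queries of the form $\mathrm{mate}(u)$, and with setup cost - $O(n)$, if the memory model allows getting an uninitialized memory chunk of size $n\times n$ in constant time; - $O(n^2)$, if in the memory model one has to pay $n^2$ for a memory chunk of size $n\times n$ even when the memory is uninitialized. Here $m$ denotes the maximum number of edges of the graph during its life cycle.
   Context: Graphs are finite and undirected, on a fixed set of $n$ vertices, and are viewed as sets (or lists) of edges; $|G|$ is the number of edges of $G$. A matching of $G$ is a set $M\subseteq G$ of edges with pairwise disjoint sets of endpoints; it is maximal if there is no matching $M'\supsetneq M$ of $G$. Fully dynamic maximal matching problem: the graph is initially empty and undergoes a (possibly arbitrarily long) stream $q_1,q_2,\ldots,q_t$ of updates, each update being either the insertion $+(u,v)$ of one edge or the deletion $-(u,v)$ of one edge. For a graph $G$, $Gq_1\cdots q_i$ denotes the graph obtained from $G$ by applying the updates $q_1,\ldots,q_i$ in order. With $G$ the initial graph, $m:=\max\{|Gq_1q_2\cdots q_i| : 0\le i\le t\}$. After handling each update the algorithm must have a maximal matching $M$ of the current graph. Between the handling of updates, queries $\mathrm{mate}(u)$ may be asked; the answer is the unique vertex $v$ with $(u,v)\in M$ if such a vertex exists, and $\textsc{null}$ otherwise, where $M$ is the current maximal matching. Lookahead of length $m$: at any moment the algorithm may inspect the next $m$ not yet processed operations of the stream. The setup cost is the cost of a one-time initialization at the start of the program, and is not counted in the update cost. The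 amortized update cost is the total time spent on handling the updates divided by the number of updates. Array entries (indexed by vertices or by pairs of vertices) can be accessed in constant time; an uninitialized memory chunk is one whose entries have arbitrary initial contents. *)

theory Defs
  imports Complex_Main
begin

section \<open>Graphs, matchings and update streams\<close>

text \<open>
  The vertex set is \<open>{..<n}\<close>; a graph is the set of its edges, an undirected edge being
  the two-element set of its endpoints.
\<close>

type_synonym edge = "nat set"
type_synonym graph = "edge set"

definition matching :: "graph \<Rightarrow> edge set \<Rightarrow> bool" where
  "matching G M \<longleftrightarrow> M \<subseteq> G \<and> pairwise disjnt M"

definition maximal_matching :: "graph \<Rightarrow> edge set \<Rightarrow> bool" where
  "maximal_matching G M \<longleftrightarrow> matching G M \<and> (\<nexists>M'. matching G M' \<and> M \<subset> M')"

definition mate :: "edge set \<Rightarrow> nat \<Rightarrow> nat option" where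
  "mate M u = (if \<exists>v. {u, v} \<in> M then Some (THE v. {u, v} \<in> M) else None)"

datatype op = Ins nat nat | Del nat nat

fun valid_op :: "nat \<Rightarrow> op \<Rightarrow> bool" where
  "valid_op n (Ins u v) \<longleftrightarrow> u < n \<and> v < n \<and> u \<noteq> v"
| "valid_op n (Del u v) \<longleftrightarrow> u < n \<and> v < n \<and> u \<noteq> v"

text \<open>Inserting a present edge or deleting an absent one is allowed and has no effect.\<close>

fun apply_op :: "op \<Rightarrow> graph \<Rightarrow> graph" where
  "apply_op (Ins u v) G = insert {u, v} G"
| "apply_op (Del u v) G = G - {{u, v}}"

definition graph_after :: "op list \<Rightarrow> nat \<Rightarrow> graph" where
  "graph_after qs i = fold apply_op (take i qs) {}"

definition max_edges :: "op list \<Rightarrow> nat" where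
  "max_edges qs = Max ((\<lambda>i. card (graph_after qs i)) ` {0..length qs})"

section \<open>A word RAM with two-dimensional memory chunks\<close>

text \<open>
  A program uses finitely many registers and finitely many named memory chunks, all holding
  machine words. Arithmetic is modulo \<open>word_bound\<close>, so that numbers of unbounded size cannot
  be used to do work for free. The contents of the \<open>k\<close>-th chunk handed out by the memory
  manager are \<open>junk k\<close>, which is arbitrary.
\<close>

datatype alloc_model =
    Constant_Alloc  \<comment> \<open>an uninitialized chunk costs a constant, whatever its size\<close>
  | Linear_Alloc    \<comment> \<open>an uninitialized chunk costs its size\<close>

record machine =
  word_bound :: nat
  alloc_model :: alloc_model
  junk :: "nat \<Rightarrow> nat \<Rightarrow> nat \<Rightarrow> nat"

record state =
  reg :: "nat \<Rightarrow> nat"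
  rows :: "nat \<Rightarrow> nat"
  cols :: "nat \<Rightarrow> nat"
  cell :: "nat \<Rightarrow> nat \<Rightarrow> nat \<Rightarrow> nat"
  allocs :: nat

text \<open>
  \<open>Op_Kind e\<close>, \<open>Op_Fst e\<close> and \<open>Op_Snd e\<close> inspect the update at distance \<open>e\<close> in the
  lookahead window. They are the only access a program has to the stream.
\<close>

datatype exp =
    Const nat
  | Reg nat
  | Cell nat exp exp
  | Add exp exp
  | Sub exp exp
  | Mul exp exp
  | Div exp exp
  | Mod exp exp
  | Op_Kind exp
  | Op_Fst exp
  | Op_Snd exp

datatype test =
    Less exp exp
  | Equal exp exp
  | Neg test
  | Conj test test

datatype com =
    Skip
  | Assign nat exp
  | Store nat exp exp exp
  | Alloc nat exp exp
  | Seq com com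
  | If test com com
  | While test com

fun op_kind :: "op \<Rightarrow> nat" where
  "op_kind (Ins u v) = 1"
| "op_kind (Del u v) = 2"

fun op_fst :: "op \<Rightarrow> nat" where
  "op_fst (Ins u v) = u"
| "op_fst (Del u v) = u"

fun op_snd :: "op \<Rightarrow> nat" where
  "op_snd (Ins u v) = v"
| "op_snd (Del u v) = v"

text \<open>
  Accesses are bounds-checked: reading outside a chunk, or beyond the end of the lookahead
  window, yields \<open>0\<close>, and storing outside a chunk has no effect. Subtraction is truncated
  at \<open>0\<close>.
\<close>

definition in_bounds :: "state \<Rightarrow> nat \<Rightarrow> nat \<Rightarrow> nat \<Rightarrow> bool" where
  "in_bounds s a i j \<longleftrightarrow> i < rows s a \<and> j < cols s a"

definition inspect :: "(op \<Rightarrow> nat) \<Rightarrow> op list \<Rightarrow> nat \<Rightarrow> nat" where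
  "inspect f win d = (if d < length win then f (win ! d) else 0)"

fun eval :: "machine \<Rightarrow> op list \<Rightarrow> state \<Rightarrow> exp \<Rightarrow> nat" where
  "eval N win s (Const c) = c mod word_bound N"
| "eval N win s (Reg x) = reg s x"
| "eval N win s (Cell a e1 e2) =
     (let i = eval N win s e1; j = eval N win s e2
      in if in_bounds s a i j then cell s a i j else 0)"
| "eval N win s (Add e1 e2) = (eval N win s e1 + eval N win s e2) mod word_bound N"
| "eval N win s (Sub e1 e2) = eval N win s e1 - eval N win s e2"
| "eval N win s (Mul e1 e2) = (eval N win s e1 * eval N win s e2) mod word_bound N"
| "eval N win s (Div e1 e2) = eval N win s e1 div eval N win s e2"
| "eval N win s (Mod e1 e2) = eval N win s e1 mod eval N win s e2"
| "eval N win s (Op_Kind e) = inspect op_kind win (eval N win s e)"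
| "eval N win s (Op_Fst e) = inspect op_fst win (eval N win s e)"
| "eval N win s (Op_Snd e) = inspect op_snd win (eval N win s e)"

fun holds :: "machine \<Rightarrow> op list \<Rightarrow> state \<Rightarrow> test \<Rightarrow> bool" where
  "holds N win s (Less e1 e2) \<longleftrightarrow> eval N win s e1 < eval N win s e2"
| "holds N win s (Equal e1 e2) \<longleftrightarrow> eval N win s e1 = eval N win s e2"
| "holds N win s (Neg b) \<longleftrightarrow> \<not> holds N win s b"
| "holds N win s (Conj b1 b2) \<longleftrightarrow> holds N win s b1 \<and> holds N win s b2"

definition store :: "nat \<Rightarrow> nat \<Rightarrow> nat \<Rightarrow> nat \<Rightarrow> state \<Rightarrow> state" where
  "store a i j x s =
     (if in_bounds s a i j
      then s\<lparr>cell := (cell s)(a := (cell s a)(i := (cell s a i)(j := x)))\<rparr> else s)"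

definition alloc :: "machine \<Rightarrow> nat \<Rightarrow> nat \<Rightarrow> nat \<Rightarrow> state \<Rightarrow> state" where
  "alloc N a r c s =
     s\<lparr>rows := (rows s)(a := r),
       cols := (cols s)(a := c),
       cell := (cell s)(a := (\<lambda>i j. junk N (allocs s) i j mod word_bound N)),
       allocs := Suc (allocs s)\<rparr>"

fun alloc_cost :: "alloc_model \<Rightarrow> nat \<Rightarrow> nat \<Rightarrow> nat" where
  "alloc_cost Constant_Alloc r c = 1"
| "alloc_cost Linear_Alloc r c = 1 + r * c"

text \<open>
  \<open>exec N win c s t s'\<close>: with lookahead window \<open>win\<close>, the program \<open>c\<close> started in \<open>s\<close>
  terminates in \<open>s'\<close> after time \<open>t\<close>. One elementary command or one test takes one unit:
  the number of operators in it is fixed by the program, so counting each of them would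
  change the time only by a factor that depends on the program alone.
\<close>

inductive exec :: "machine \<Rightarrow> op list \<Rightarrow> com \<Rightarrow> state \<Rightarrow> nat \<Rightarrow> state \<Rightarrow> bool"
  for N :: machine and win :: "op list" where
  Skip: "exec N win Skip s 1 s"
| Assign: "exec N win (Assign x e) s 1 (s\<lparr>reg := (reg s)(x := eval N win s e)\<rparr>)"
| Store: "exec N win (Store a e1 e2 e) s 1
            (store a (eval N win s e1) (eval N win s e2) (eval N win s e) s)"
| Alloc: "exec N win (Alloc a e1 e2) s
            (alloc_cost (alloc_model N) (eval N win s e1) (eval N win s e2))
            (alloc N a (eval N win s e1) (eval N win s e2) s)"
| Seq: "exec N win c1 s1 t1 s2 \<Longrightarrow> exec N win c2 s2 t2 s3 \<Longrightarrow>
          exec N win (Seq c1 c2) s1 (t1 + t2) s3"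
| IfTrue: "holds N win s b \<Longrightarrow> exec N win c1 s t s' \<Longrightarrow> exec N win (If b c1 c2) s (1 + t) s'"
| IfFalse: "\<not> holds N win s b \<Longrightarrow> exec N win c2 s t s' \<Longrightarrow> exec N win (If b c1 c2) s (1 + t) s'"
| WhileFalse: "\<not> holds N win s b \<Longrightarrow> exec N win (While b c) s 1 s"
| WhileTrue: "holds N win s1 b \<Longrightarrow> exec N win c s1 t1 s2 \<Longrightarrow> exec N win (While b c) s2 t2 s3 \<Longrightarrow>
          exec N win (While b c) s1 (1 + t1 + t2) s3"

inductive_cases exec_SkipE: "exec N win Skip s t s'"
  and exec_AssignE: "exec N win (Assign x e) s t s'"
  and exec_StoreE: "exec N win (Store a e1 e2 e) s t s'"
  and exec_AllocE: "exec N win (Alloc a e1 e2) s t s'"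
  and exec_SeqE: "exec N win (Seq c1 c2) s t s'"
  and exec_IfE: "exec N win (If b c1 c2) s t s'"
  and exec_WhileE: "exec N win (While b c) s t s'"

theorem exec_deterministic:
  assumes "exec N win c s t1 s1" and "exec N win c s t2 s2"
  shows "t1 = t2 \<and> s1 = s2"
  using assms
proof (induction arbitrary: t2 s2 rule: exec.induct)
  case (Skip s)
  then show ?case by (rule exec_SkipE) simp
next
  case (Assign x e s)
  then show ?case by (rule exec_AssignE) simp
next
  case (Store a e1 e2 e s)
  then show ?case by (rule exec_StoreE) simp
next
  case (Alloc a e1 e2 s)
  then show ?case by (rule exec_AllocE) simp
next
  case (Seq c1 s1 u1 s2' c2 u2 s3)
  from Seq.prems show ?case by (rule exec_SeqE) (auto dest!: Seq.IH)
next
  case (IfTrue s b c1 t s' c2)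
  from IfTrue.prems show ?case by (rule exec_IfE) (auto simp: IfTrue.hyps(1) dest!: IfTrue.IH)
next
  case (IfFalse s b c2 t s' c1)
  from IfFalse.prems show ?case by (rule exec_IfE) (auto simp: IfFalse.hyps(1) dest!: IfFalse.IH)
next
  case (WhileFalse s b c)
  from WhileFalse.prems show ?case by (rule exec_WhileE) (simp_all add: WhileFalse.hyps)
next
  case (WhileTrue s1 b c u1 s2' u2 s3)
  from WhileTrue.prems show ?case by (rule exec_WhileE) (auto simp: WhileTrue.hyps(1) dest!: WhileTrue.IH)
qed

section \<open>Dynamic algorithms with lookahead\<close>

record algorithm =
  setup_prog :: com
  update_prog :: com
  query_prog :: com

text \<open>
  Register \<open>0\<close> is the input/output register: it holds \<open>n\<close> when the setup starts, the vertex
  \<open>u\<close> when the query \<open>mate(u)\<close> starts, and the answer when that query ends.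
\<close>

definition initial_state :: "nat \<Rightarrow> state" where
  "initial_state n =
     \<lparr>reg = (\<lambda>_. 0)(0 := n), rows = (\<lambda>_. 0), cols = (\<lambda>_. 0), cell = (\<lambda>_ _ _. 0), allocs = 0\<rparr>"

fun encode_mate :: "nat option \<Rightarrow> nat" where
  "encode_mate None = 0"
| "encode_mate (Some v) = Suc v"

datatype event = Update op | Query nat

fun updates :: "event list \<Rightarrow> op list" where
  "updates [] = []"
| "updates (Update q # es) = q # updates es"
| "updates (Query u # es) = updates es"

text \<open>
  \<open>run A N m s es out\<close>: in state \<open>s\<close>, the algorithm handles the events \<open>es\<close> one after the
  other; \<open>out\<close> lists, for each event, the time taken and the final content of register \<open>0\<close>.
  The window always consists of the next \<open>m\<close> updates that are not yet processed, the one
  being handled included.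
\<close>

inductive run :: "algorithm \<Rightarrow> machine \<Rightarrow> nat \<Rightarrow> state \<Rightarrow> event list \<Rightarrow> (nat \<times> nat) list \<Rightarrow> bool"
  for A :: algorithm and N :: machine and m :: nat where
  Nil: "run A N m s [] []"
| Update: "exec N (take m (q # updates es)) (update_prog A) s t s' \<Longrightarrow> run A N m s' es out \<Longrightarrow>
    run A N m s (Update q # es) ((t, reg s' 0) # out)"
| Query: "exec N (take m (updates es)) (query_prog A) (s\<lparr>reg := (reg s)(0 := u)\<rparr>) t s' \<Longrightarrow>
    run A N m s' es out \<Longrightarrow>
    run A N m s (Query u # es) ((t, reg s' 0) # out)"

fun is_update :: "event \<Rightarrow> bool" where
  "is_update (Update q) \<longleftrightarrow> True"
| "is_update (Query u) \<longleftrightarrow> False"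

definition total_update_time :: "event list \<Rightarrow> (nat \<times> nat) list \<Rightarrow> nat" where
  "total_update_time es out = (\<Sum>i | i < length es \<and> is_update (es ! i). fst (out ! i))"

text \<open>
  The setup bounds \<open>O(n)\<close> and \<open>O(n^2)\<close>; the \<open>1\<close> is for \<open>n = 0\<close>, as a program takes at least
  one step.
\<close>

fun setup_bound :: "alloc_model \<Rightarrow> nat \<Rightarrow> nat" where
  "setup_bound Constant_Alloc n = n + 1"
| "setup_bound Linear_Alloc n = n ^ 2 + 1"

end

theory Submission
  imports Defs
begin

text \<open>
  The stream is cut into phases of \<open>m\<close> updates, all known at the start of the phase by lookahead.
  A phase replays the insertion of the current edges followed by the real updates, starting from the
  empty graph at time 0, so it has at most \<open>2 m\<close> entries. Time is divided into dyadic blocks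
  \<open>[s, s + 2^j)\<close>. When time \<open>s\<close> is reached, the blocks starting at \<open>s\<close> are processed from the
  widest to the narrowest: every edge present during the whole block whose end points are both free
  is matched until the end of the block. By induction over the block widths, every edge present
  throughout a block then has an end point that stays matched throughout the block; blocks of width
  1 give maximality. An edge that is present throughout a block but not throughout its parent block
  is touched by an entry of the parent block, so for a block of width \<open>w\<close> only the entries of the
  parent block, at most \<open>2 w\<close>, need to be examined. This makes the cost of a phase \<open>O(m log m)\<close>.

  No undo is needed: a vertex is matched iff its stored expiry time exceeds the current time. The
  \<open>n \<times> n\<close> arrays are never initialized as a whole; each phase resets the positions of its own edges.
\<close>

text \<open>Greedy matching per block works because every expiry time is the end of a dyadic block
  and dyadic blocks are nested: a vertex still matched when a block is processed stays matched to
  the end of that block. So an edge present throughout the block is either chosen or blocked for the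
  whole width. Going from wide to narrow keeps this true among the blocks that share a starting
  time. A chosen edge is present until it expires, so no deletion ever hits the matching.

  Replaying the current edges from the empty graph gives the induction over widths its base: the
  widest blocks have a parent that contains time 0, and there no edge is present. The replayed
  entries are run through by the update that starts the phase.

  The program is not told \<open>m\<close>. A phase takes whatever the window shows, and the end of
  the window is recognised by the operation kind 0. Phases begin at multiples of \<open>m\<close>,
  and \<open>m\<close> is at most the number of updates since an update adds at most one edge; this
  is why even a last, incomplete phase amortizes.\<close>

definition wp :: "machine \<Rightarrow> op list \<Rightarrow> com \<Rightarrow> state \<Rightarrow> (nat \<Rightarrow> state \<Rightarrow> bool) \<Rightarrow> bool" where
  "wp N win c s Q \<longleftrightarrow> (\<exists>t s'. exec N win c s t s' \<and> Q t s')"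

text \<open>Determinism makes the existential in \<open>wp\<close> an equivalence, so that
  straight-line code is executed symbolically by rewriting with \<open>wp_simps\<close>.\<close>

lemma wp_exec: "exec N win c s t s' \<Longrightarrow> wp N win c s Q \<longleftrightarrow> Q t s'"
  unfolding wp_def using exec_deterministic by blast

lemmas wp_Skip = wp_exec[OF exec.Skip]
  and wp_Assign = wp_exec[OF exec.Assign]
  and wp_Store = wp_exec[OF exec.Store]
  and wp_Alloc = wp_exec[OF exec.Alloc]

lemma wp_Seq:
  "wp N win (Seq c1 c2) s Q \<longleftrightarrow>
     wp N win c1 s (\<lambda>t1 s1. wp N win c2 s1 (\<lambda>t2 s2. Q (t1 + t2) s2))"
  unfolding wp_def by (blast elim: exec_SeqE intro: exec.Seq)

lemma wp_If:
  "wp N win (If b c1 c2) s Q \<longleftrightarrow>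
     (if holds N win s b then wp N win c1 s (\<lambda>t. Q (1 + t)) else wp N win c2 s (\<lambda>t. Q (1 + t)))"
  (is "_ = ?r")
proof
  assume "wp N win (If b c1 c2) s Q"
  then obtain t s' where "exec N win (If b c1 c2) s t s'" "Q t s'" unfolding wp_def by blast
  then show ?r unfolding wp_def by (cases rule: exec_IfE) auto
next
  assume ?r
  then show "wp N win (If b c1 c2) s Q"
    unfolding wp_def by (metis exec.IfTrue exec.IfFalse)
qed

lemmas wp_simps = wp_Skip wp_Assign wp_Store wp_Seq wp_If

lemma wp_conseq:
  assumes "wp N win c s Q" and "\<And>t s'. exec N win c s t s' \<Longrightarrow> Q t s' \<Longrightarrow> R t s'"
  shows "wp N win c s R"
  using assms unfolding wp_def by blast

text \<open>The function \<open>f\<close> is at once the termination measure and the remaining time budget.\<close>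

lemma wp_While:
  assumes "I s"
    and body: "\<And>s. I s \<Longrightarrow> holds N win s b \<Longrightarrow> wp N win c s (\<lambda>t s'. I s' \<and> 1 + t + f s' \<le> f s)"
  shows "wp N win (While b c) s (\<lambda>t s'. I s' \<and> \<not> holds N win s' b \<and> t + f s' \<le> f s + 1)"
  using assms(1)
proof (induction "f s" arbitrary: s rule: less_induct)
  case less
  show ?case
  proof (cases "holds N win s b")
    case False
    then have "exec N win (While b c) s 1 s" by (rule exec.WhileFalse)
    then show ?thesis using less.prems False unfolding wp_def by fastforce
  next
    case True
    from body[OF less.prems this] obtain t s' where
      1: "exec N win c s t s'" "I s'" "1 + t + f s' \<le> f s" unfolding wp_def by blast
    with less.hyps[of s'] obtain t' s'' where
      2: "exec N win (While b c) s' t' s''" "I s''" "\<not> holds N win s'' b" "t' + f s'' \<le> f s' + 1"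
      unfolding wp_def by auto
    have "exec N win (While b c) s (1 + t + t') s''" by (rule exec.WhileTrue[OF True 1(1) 2(1)])
    moreover have "1 + t + t' + f s'' \<le> f s + 1" using 1(3) 2(4) by linarith
    ultimately show ?thesis using 2 unfolding wp_def by blast
  qed
qed

section \<open>Frame conditions: what a program leaves unchanged\<close>

fun regs_of :: "com \<Rightarrow> nat set" where
  "regs_of (Assign x e) = {x}"
| "regs_of (Seq c1 c2) = regs_of c1 \<union> regs_of c2"
| "regs_of (If b c1 c2) = regs_of c1 \<union> regs_of c2"
| "regs_of (While b c) = regs_of c"
| "regs_of _ = {}"

fun chunks_of :: "com \<Rightarrow> nat set" where
  "chunks_of (Store a e1 e2 e) = {a}"
| "chunks_of (Alloc a e1 e2) = {a}"
| "chunks_of (Seq c1 c2) = chunks_of c1 \<union> chunks_of c2"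
| "chunks_of (If b c1 c2) = chunks_of c1 \<union> chunks_of c2"
| "chunks_of (While b c) = chunks_of c"
| "chunks_of _ = {}"

fun alloc_free :: "com \<Rightarrow> bool" where
  "alloc_free (Alloc a e1 e2) = False"
| "alloc_free (Seq c1 c2) \<longleftrightarrow> alloc_free c1 \<and> alloc_free c2"
| "alloc_free (If b c1 c2) \<longleftrightarrow> alloc_free c1 \<and> alloc_free c2"
| "alloc_free (While b c) \<longleftrightarrow> alloc_free c"
| "alloc_free _ = True"

lemma store_simps [simp]:
  "reg (store a i j x s) = reg s"
  "rows (store a i j x s) = rows s"
  "cols (store a i j x s) = cols s"
  "cell (store a i j x s) b i' j' =
     (if b = a \<and> i' = i \<and> j' = j \<and> in_bounds s a i j then x else cell s b i' j')"
  "b \<noteq> a \<Longrightarrow> cell (store a i j x s) b = cell s b"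
  "in_bounds (store a i j x s) b i' j' = in_bounds s b i' j'"
  by (auto simp: store_def in_bounds_def)

lemma in_bounds_reg [simp]: "in_bounds (s\<lparr>reg := r\<rparr>) a i j = in_bounds s a i j"
  by (simp add: in_bounds_def)

lemma exec_reg: "exec N win c s t s' \<Longrightarrow> r \<notin> regs_of c \<Longrightarrow> reg s' r = reg s r"
  by (induction rule: exec.induct) (auto simp: alloc_def)

lemma exec_cell: "exec N win c s t s' \<Longrightarrow> a \<notin> chunks_of c \<Longrightarrow> cell s' a = cell s a"
  by (induction rule: exec.induct) (auto simp: alloc_def)

lemma exec_rows: "exec N win c s t s' \<Longrightarrow> alloc_free c \<Longrightarrow> rows s' = rows s"
  by (induction rule: exec.induct) auto

lemma exec_cols: "exec N win c s t s' \<Longrightarrow> alloc_free c \<Longrightarrow> cols s' = cols s"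
  by (induction rule: exec.induct) auto

section \<open>Dyadic blocks and the matching they determine\<close>

abbreviation op_edge :: "op \<Rightarrow> edge" where
  "op_edge q \<equiv> {op_fst q, op_snd q}"

text \<open>Entries are numbered from 1: entry \<open>t\<close> leads from
  \<open>graph_at P (t - 1)\<close> to \<open>graph_at P t\<close>, and time 0 is left to the empty
  graph.\<close>

definition op_at :: "op list \<Rightarrow> nat \<Rightarrow> op" where
  "op_at P t = P ! (t - 1)"

definition graph_at :: "op list \<Rightarrow> nat \<Rightarrow> graph" where
  "graph_at P t = fold apply_op (take t P) {}"

definition block_start :: "nat \<Rightarrow> nat \<Rightarrow> nat" where
  "block_start w i = i - i mod w"

definition permanent :: "op list \<Rightarrow> nat \<Rightarrow> nat \<Rightarrow> graph" where
  "permanent P w i = {e. \<forall>t\<in>{block_start w i..<block_start w i + w}. e \<in> graph_at P t}"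

text \<open>Only the end \<open>b\<close> of a block enters: at a time inside the block,
  \<open>b \<le> ex u\<close> already says that \<open>u\<close> stays matched through the rest of
  it.\<close>

definition covered :: "(nat \<Rightarrow> nat) \<Rightarrow> edge \<Rightarrow> nat \<Rightarrow> bool" where
  "covered ex e b \<longleftrightarrow> (\<exists>u\<in>e. b \<le> ex u)"

text \<open>Partners share their expiry and their edge is present until then, so the mere passing of
  time cannot invalidate the matching.\<close>

definition matched_ok :: "op list \<Rightarrow> nat \<Rightarrow> nat \<Rightarrow> (nat \<Rightarrow> nat) \<Rightarrow> (nat \<Rightarrow> nat) \<Rightarrow> bool" where
  "matched_ok P n i ex mt \<longleftrightarrow> (\<forall>u<n. i < ex u \<longrightarrow>
     (\<exists>v<n. v \<noteq> u \<and> mt u = Suc v \<and> mt v = Suc u \<and> ex v = ex u \<and>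
        (\<forall>t\<in>{i..<ex u}. {u, v} \<in> graph_at P t)))"

text \<open>What is kept of the fact that expiry times are ends of dyadic blocks: a block starting
  strictly inside a matched period also ends inside it. Blocks starting at \<open>i\<close> itself
  are excluded because a pair matched at \<open>i\<close> for one width does not span the wider
  blocks at \<open>i\<close>.\<close>

definition nested :: "nat \<Rightarrow> nat \<Rightarrow> (nat \<Rightarrow> nat) \<Rightarrow> bool" where
  "nested n i ex \<longleftrightarrow> (\<forall>u<n. \<forall>t l. i < t \<longrightarrow> t < ex u \<longrightarrow> 2 ^ l dvd t \<longrightarrow> t + 2 ^ l \<le> ex u)"

text \<open>
  The invariant at time \<open>i\<close> when the blocks of width at most \<open>w\<close> starting at \<open>i\<close> are still to
  be processed; with \<open>w = 0\<close> all of them have been.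
\<close>

definition level_inv ::
  "op list \<Rightarrow> nat \<Rightarrow> nat \<Rightarrow> nat \<Rightarrow> nat \<Rightarrow> (nat \<Rightarrow> nat) \<Rightarrow> (nat \<Rightarrow> nat) \<Rightarrow> bool" where
  "level_inv P n K i w ex mt \<longleftrightarrow>
     matched_ok P n i ex mt \<and> nested n i ex \<and>
     (\<forall>u<n. i < ex u \<longrightarrow> (\<forall>l. 2 ^ l \<le> w \<longrightarrow> 2 ^ l dvd i \<longrightarrow> i + 2 ^ l \<le> ex u)) \<and>
     (\<forall>j\<le>K. w < 2 ^ j \<or> \<not> 2 ^ j dvd i \<longrightarrow>
        (\<forall>e\<in>permanent P (2 ^ j) i. covered ex e (block_start (2 ^ j) i + 2 ^ j))) \<and>
     (\<forall>u<n. ex u \<noteq> 0 \<longrightarrow> (\<exists>t. 1 \<le> t \<and> t \<le> length P \<and> u \<in> op_edge (op_at P t)))"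

section \<open>The graph over time and the nesting of dyadic blocks\<close>

lemma graph_at_0 [simp]: "graph_at P 0 = {}"
  by (simp add: graph_at_def)

lemma graph_at_step:
  assumes "1 \<le> t" "t \<le> length P"
  shows "graph_at P t = apply_op (op_at P t) (graph_at P (t - 1))"
proof -
  obtain k where "t = Suc k" using assms by (cases t) auto
  then show ?thesis using assms by (simp add: graph_at_def op_at_def take_Suc_conv_app_nth)
qed

lemma graph_at_beyond: "length P \<le> t \<Longrightarrow> graph_at P t = graph_at P (length P)"
  by (simp add: graph_at_def)

lemma apply_op_iff:
  "e \<in> apply_op q G \<longleftrightarrow> (if e = op_edge q then op_kind q = 1 else e \<in> G)"
  by (cases q) auto

lemma graph_at_step_iff:
  assumes "1 \<le> t"
  shows "e \<in> graph_at P t \<longleftrightarrow>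
    (if t \<le> length P \<and> e = op_edge (op_at P t) then op_kind (op_at P t) = 1 else e \<in> graph_at P (t - 1))"
proof (cases "t \<le> length P")
  case True
  then show ?thesis using assms by (simp add: graph_at_step apply_op_iff)
next
  case False
  then show ?thesis using graph_at_beyond[of P t] graph_at_beyond[of P "t - 1"] by auto
qed

lemma op_kind_cases: "op_kind q = 1 \<or> op_kind q = 2"
  by (cases q) auto

lemma block_start_le: "block_start w i \<le> i"
  by (simp add: block_start_def)

lemma block_end_gt: "0 < w \<Longrightarrow> i < block_start w i + w"
  unfolding block_start_def using mod_less_divisor[of w i] by linarith

lemma block_start_dvd: "w dvd i \<Longrightarrow> block_start w i = i"
  by (auto simp: block_start_def)

lemma block_start_pred:
  assumes "\<not> w dvd i" "1 \<le> i"
  shows "block_start w (i - 1) = block_start w i"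
proof -
  obtain k where k: "i = Suc k" using assms by (cases i) auto
  have "Suc k mod w \<noteq> 0" using assms k by (simp add: dvd_eq_mod_eq_0)
  then have "Suc k mod w = Suc (k mod w)" by (auto simp: mod_Suc split: if_splits)
  then show ?thesis using k by (simp add: block_start_def)
qed

text \<open>The entry at \<open>lo\<close> is already reflected in \<open>graph_at P lo\<close>, so
  a change inside \<open>[lo, hi)\<close> is caused by an entry strictly after \<open>lo\<close>.
  This is what restricts the candidates for a block to the entries of its parent.\<close>

lemma change_between:
  assumes "e \<in> graph_at P a" "e \<notin> graph_at P b" "lo \<le> a" "a < hi" "lo \<le> b" "b < hi"
  shows "\<exists>t. lo < t \<and> t < hi \<and> t \<le> length P \<and> e = op_edge (op_at P t)"
proof (rule ccontr)
  assume no: "\<not> ?thesis"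
  have const: "e \<in> graph_at P (lo + d) \<longleftrightarrow> e \<in> graph_at P lo" if "lo + d < hi" for d
    using that
  proof (induction d)
    case (Suc d)
    have "\<not> (lo + Suc d \<le> length P \<and> e = op_edge (op_at P (lo + Suc d)))"
      using no Suc.prems by auto
    then have "e \<in> graph_at P (lo + Suc d) \<longleftrightarrow> e \<in> graph_at P (lo + d)"
      by (subst graph_at_step_iff) auto
    then show ?case using Suc by simp
  qed simp
  show False using const[of "a - lo"] const[of "b - lo"] assms by simp
qed

lemma pow2_dvd_add_le:
  assumes "2 ^ l dvd (t::nat)" "2 ^ l dvd x" "t < x"
  shows "t + 2 ^ l \<le> x"
proof -
  have "2 ^ l dvd x - t" using assms by (simp add: dvd_diff_nat)
  then show ?thesis using assms(3) by (auto dest!: dvd_imp_le)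
qed

text \<open>If \<open>l \<le> j\<close>, both \<open>t\<close> and \<open>i + 2 ^ j\<close> are
  multiples of \<open>2 ^ l\<close>, hence at least \<open>2 ^ l\<close> apart. If \<open>l\<close>
  is larger, no such \<open>t\<close> exists: it would be a multiple of \<open>2 ^ j\<close>
  strictly between two consecutive ones.\<close>

lemma nested_block:
  assumes "2 ^ j dvd (i::nat)" "i < t" "t < i + 2 ^ j" "2 ^ l dvd t"
  shows "t + 2 ^ l \<le> i + 2 ^ j"
proof (cases "l \<le> j")
  case True
  then have "2 ^ l dvd (2::nat) ^ j" by (simp add: le_imp_power_dvd)
  then have "2 ^ l dvd i + 2 ^ j" using assms(1) by (meson dvd_add dvd_trans)
  then show ?thesis using pow2_dvd_add_le assms by blast
next
  case False
  then have "2 ^ j dvd (2::nat) ^ l" by (simp add: le_imp_power_dvd)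
  then have "2 ^ j dvd t" using assms(4) dvd_trans by blast
  then have "i + 2 ^ j \<le> t" using pow2_dvd_add_le assms by blast
  then show ?thesis using assms(3) by linarith
qed

lemma covered_mono: "covered ex e b \<Longrightarrow> (\<And>u. b \<le> ex u \<Longrightarrow> b \<le> ex' u) \<Longrightarrow> covered ex' e b"
  unfolding covered_def by blast

section \<open>How the invariant moves through times and widths\<close>

lemma level_inv_start:
  assumes "\<And>u. u < n \<Longrightarrow> ex u = 0"
  shows "level_inv P n K 0 0 ex mt"
proof -
  have "permanent P (2 ^ j) 0 = {}" for j by (auto simp: permanent_def block_start_def intro: bexI[of _ 0])
  then show ?thesis using assms by (simp add: level_inv_def matched_ok_def nested_def)
qed

text \<open>A block that does not start at \<open>Suc i\<close> is the block that already contained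
  \<open>i\<close>, so its coverage carries over; all blocks that do start there are still to be
  processed. That vertices matched beyond \<open>Suc i\<close> span these blocks is the instance of
  \<open>nested\<close> at the new time.\<close>

lemma level_inv_next:
  assumes "level_inv P n K i 0 ex mt"
  shows "level_inv P n K (Suc i) (2 ^ K) ex mt"
proof -
  have "covered ex e (block_start (2 ^ j) (Suc i) + 2 ^ j)"
    if "j \<le> K" "(2::nat) ^ K < 2 ^ j \<or> \<not> 2 ^ j dvd Suc i" "e \<in> permanent P (2 ^ j) (Suc i)" for j e
  proof -
    have "\<not> (2::nat) ^ K < 2 ^ j" using that(1) by (simp add: not_less)
    with that have "\<not> 2 ^ j dvd Suc i" by blast
    from block_start_pred[OF this] have "block_start (2 ^ j) i = block_start (2 ^ j) (Suc i)" by simp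
    then show ?thesis using assms that unfolding level_inv_def permanent_def by auto
  qed
  moreover have "matched_ok P n (Suc i) ex mt"
    unfolding matched_ok_def
  proof (intro allI impI)
    fix u assume "u < n" "Suc i < ex u"
    then obtain v where "v < n" "v \<noteq> u" "mt u = Suc v" "mt v = Suc u" "ex v = ex u"
      "\<forall>t\<in>{i..<ex u}. {u, v} \<in> graph_at P t"
      using assms unfolding level_inv_def matched_ok_def by (meson Suc_lessD)
    then show "\<exists>v<n. v \<noteq> u \<and> mt u = Suc v \<and> mt v = Suc u \<and> ex v = ex u \<and>
        (\<forall>t\<in>{Suc i..<ex u}. {u, v} \<in> graph_at P t)" by auto
  qed
  moreover have "nested n (Suc i) ex"
    using assms unfolding level_inv_def nested_def by (meson Suc_lessD)
  moreover have "Suc i + 2 ^ l \<le> ex u" if "u < n" "Suc i < ex u" "2 ^ l dvd Suc i" for u l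
    using assms that unfolding level_inv_def nested_def by blast
  ultimately show ?thesis using assms unfolding level_inv_def by blast
qed

lemma level_inv_match:
  assumes inv: "level_inv P n K i w ex mt" and w: "w = 2 ^ j" "w dvd i"
    and uv: "u < n" "v < n" "u \<noteq> v" and free: "ex u \<le> i" "ex v \<le> i"
    and pres: "\<And>t. i \<le> t \<Longrightarrow> t < i + w \<Longrightarrow> {u, v} \<in> graph_at P t"
    and t: "1 \<le> t" "t \<le> length P" "{u, v} = op_edge (op_at P t)"
    and ex': "\<And>x. ex' x = (if x = u \<or> x = v then i + w else ex x)"
    and mt': "\<And>x. mt' x = (if x = u then Suc v else if x = v then Suc u else mt x)"
  shows "level_inv P n K i w ex' mt'"
proof -
  have m: "matched_ok P n i ex mt" and ne: "nested n i ex" using inv by (simp_all add: level_inv_def)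
  have "matched_ok P n i ex' mt'"
    unfolding matched_ok_def
  proof (intro allI impI)
    fix x assume x: "x < n" "i < ex' x"
    show "\<exists>y<n. y \<noteq> x \<and> mt' x = Suc y \<and> mt' y = Suc x \<and> ex' y = ex' x \<and>
      (\<forall>t\<in>{i..<ex' x}. {x, y} \<in> graph_at P t)"
    proof (cases "x = u \<or> x = v")
      case True
      then show ?thesis
      proof
        assume "x = u"
        then show ?thesis using uv pres by (intro exI[of _ v]) (simp add: ex' mt')
      next
        assume "x = v"
        then show ?thesis using uv pres by (intro exI[of _ u]) (simp add: ex' mt' insert_commute)
      qed
    next
      case False
      then have "i < ex x" using x by (simp add: ex')
      with m x obtain y where y: "y < n" "y \<noteq> x" "mt x = Suc y" "mt y = Suc x" "ex y = ex x"
        "\<forall>t\<in>{i..<ex x}. {x, y} \<in> graph_at P t" unfolding matched_ok_def by blast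
      \<comment> \<open>The partner shares the expiry of \<open>x\<close>, which is later than
        \<open>i\<close>, whereas \<open>u\<close> and \<open>v\<close> were free.\<close>
      moreover have "y \<noteq> u" "y \<noteq> v" using y(5) \<open>i < ex x\<close> free by auto
      ultimately show ?thesis using False by (intro exI[of _ y]) (simp add: ex' mt')
    qed
  qed
  \<comment> \<open>The new expiry \<open>i + w\<close> is the end of a dyadic block starting at
    \<open>i\<close>, which is the situation of \<open>nested_block\<close>.\<close>
  moreover have "nested n i ex'"
    using ne nested_block w unfolding nested_def by (simp add: ex')
  moreover have "i + 2 ^ l \<le> ex' x" if "x < n" "i < ex' x" "2 ^ l \<le> w" "2 ^ l dvd i" for x l
    using that inv unfolding level_inv_def by (auto simp: ex' split: if_splits)
  moreover have "covered ex' e (block_start (2 ^ j) i + 2 ^ j)"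
    if "j \<le> K" "w < 2 ^ j \<or> \<not> 2 ^ j dvd i" "e \<in> permanent P (2 ^ j) i" for j e
  proof (rule covered_mono)
    show "covered ex e (block_start (2 ^ j) i + 2 ^ j)" using inv that unfolding level_inv_def by blast
    \<comment> \<open>A block around \<open>i\<close> ends after \<open>i\<close>, while the
      overwritten expiries of \<open>u\<close> and \<open>v\<close> are at most \<open>i\<close>: no
      covering end point is lost.\<close>
    show "block_start (2 ^ j) i + 2 ^ j \<le> ex' x" if "block_start (2 ^ j) i + 2 ^ j \<le> ex x" for x
      using that free block_end_gt[of "2 ^ j" i] by (auto simp: ex')
  qed
  moreover have "\<exists>t. 1 \<le> t \<and> t \<le> length P \<and> x \<in> op_edge (op_at P t)" if "x < n" "ex' x \<noteq> 0" for x
  proof (cases "x = u \<or> x = v")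
    case True
    then show ?thesis using t by blast
  next
    case False
    then show ?thesis using that inv unfolding level_inv_def by (simp add: ex')
  qed
  ultimately show ?thesis unfolding level_inv_def by blast
qed

text \<open>With \<open>div\<close>, halving the width 1 gives 0, the value that stands for no block
  being left, and the equivalence includes this case.\<close>

lemma pow2_gt_half: "(2::nat) ^ j div 2 < 2 ^ k \<longleftrightarrow> j \<le> k"
proof (cases j)
  case (Suc l)
  then show ?thesis by (simp add: Suc_le_eq)
qed simp


lemma level_inv_skip:
  assumes inv: "level_inv P n K i (2 ^ j) ex mt" and "\<not> 2 ^ j dvd i"
  shows "level_inv P n K i (2 ^ j div 2) ex mt"
proof -
  have "(2::nat) ^ j < 2 ^ k \<or> \<not> 2 ^ k dvd i" if "(2::nat) ^ j div 2 < 2 ^ k" for k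
    using that assms(2) by (auto simp: pow2_gt_half le_less)
  moreover have "2 ^ l \<le> (2::nat) ^ j" if "2 ^ l \<le> (2::nat) ^ j div 2" for l
    using that by linarith
  ultimately show ?thesis using inv unfolding level_inv_def by blast
qed

text \<open>An edge permanent in the block either is permanent in the parent as well, and then it
  was covered at the next wider level, or it changes inside the parent, and then some entry examined
  for this block names it.\<close>

lemma level_inv_done:
  assumes inv: "level_inv P n K i (2 ^ j) ex mt" and j: "j \<le> K" and dvd: "2 ^ j dvd i"
    and len: "length P < 2 * 2 ^ K" and i: "i \<le> length P"
    and cov: "\<And>t. block_start (2 * 2 ^ j) i < t \<Longrightarrow> t < block_start (2 * 2 ^ j) i + 2 * 2 ^ j \<Longrightarrow>
      t \<le> length P \<Longrightarrow> op_edge (op_at P t) \<in> permanent P (2 ^ j) i \<Longrightarrow>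
      covered ex (op_edge (op_at P t)) (i + 2 ^ j)"
  shows "level_inv P n K i (2 ^ j div 2) ex mt"
proof -
  let ?b = "block_start (2 * 2 ^ j) i"
  have bi: "?b \<le> i" "i < ?b + 2 * 2 ^ j" using block_start_le block_end_gt[of "2 * 2 ^ j"] by auto
  have end_le: "i + 2 ^ j \<le> ?b + 2 * 2 ^ j"
  proof (rule pow2_dvd_add_le[OF dvd _ bi(2)])
    have "2 * 2 ^ j dvd ?b" unfolding block_start_def by (simp add: minus_mod_eq_mult_div)
    then show "2 ^ j dvd ?b + 2 * 2 ^ j" by (meson dvd_add dvd_trans dvd_triv_right)
  qed
  have new: "covered ex e (i + 2 ^ j)" if e: "e \<in> permanent P (2 ^ j) i" for e
  proof (cases "\<forall>t\<in>{?b..<?b + 2 * 2 ^ j}. e \<in> graph_at P t")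
    case True
    show ?thesis
    proof (cases "j = K")
      case True
      \<comment> \<open>The widest level: since \<open>i \<le> length P < 2 * 2 ^ K\<close>, the
        parent starts at time 0, where the graph is empty, so the first alternative cannot
        occur.\<close>
      then have "?b = 0" using len i by (simp add: block_start_def)
      then have "0 \<in> {?b..<?b + 2 * 2 ^ j}" by simp
      then have "e \<in> graph_at P 0" using \<open>\<forall>t\<in>{?b..<?b + 2 * 2 ^ j}. e \<in> graph_at P t\<close> by blast
      then show ?thesis by simp
    next
      case False
      then have "Suc j \<le> K" using j by simp
      moreover have "e \<in> permanent P (2 ^ Suc j) i" using True by (simp add: permanent_def)
      \<comment> \<open>The parent is wider than the current width, so the invariant already vouches
        for its edges, whether or not it starts at \<open>i\<close>.\<close>
      moreover have "(2::nat) ^ j < 2 ^ Suc j" by simp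
      ultimately have "covered ex e (block_start (2 ^ Suc j) i + 2 ^ Suc j)"
        using inv unfolding level_inv_def by blast
      then show ?thesis using end_le unfolding covered_def power_Suc by (meson le_trans)
    qed
  next
    case False
    then obtain t0 where t0: "?b \<le> t0" "t0 < ?b + 2 * 2 ^ j" "e \<notin> graph_at P t0" by auto
    have "e \<in> graph_at P i" using e dvd by (simp add: permanent_def block_start_dvd)
    from change_between[OF this t0(3) bi t0(1,2)] obtain t where
      "?b < t" "t < ?b + 2 * 2 ^ j" "t \<le> length P" "e = op_edge (op_at P t)" by blast
    then show ?thesis using cov e by blast
  qed
  have "covered ex e (block_start (2 ^ k) i + 2 ^ k)"
    if k: "k \<le> K" "(2::nat) ^ j div 2 < 2 ^ k \<or> \<not> 2 ^ k dvd i" "e \<in> permanent P (2 ^ k) i" for k e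
  proof (cases "k = j")
    case True
    then show ?thesis using new k dvd by (simp add: block_start_dvd)
  next
    case False
    then have "(2::nat) ^ j < 2 ^ k \<or> \<not> 2 ^ k dvd i" using k(2) by (auto simp: pow2_gt_half)
    then show ?thesis using inv k unfolding level_inv_def by blast
  qed
  moreover have "2 ^ l \<le> (2::nat) ^ j" if "2 ^ l \<le> (2::nat) ^ j div 2" for l
    using that by linarith
  ultimately show ?thesis using inv unfolding level_inv_def by blast
qed

section \<open>The maximal matching encoded by expiry times and mates\<close>

definition matching_of :: "nat \<Rightarrow> nat \<Rightarrow> (nat \<Rightarrow> nat) \<Rightarrow> (nat \<Rightarrow> nat) \<Rightarrow> edge set" where
  "matching_of n i ex mt = {{u, v} |u v. u < n \<and> i < ex u \<and> mt u = Suc v}"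

lemma matching_of_mate:
  assumes m: "matched_ok P n i ex mt" and u: "u < n"
  shows "{u, v} \<in> matching_of n i ex mt \<longleftrightarrow> i < ex u \<and> mt u = Suc v"
proof
  assume "{u, v} \<in> matching_of n i ex mt"
  then obtain a b where ab: "{u, v} = {a, b}" "a < n" "i < ex a" "mt a = Suc b"
    unfolding matching_of_def by blast
  with m obtain y where "y \<noteq> a" "mt a = Suc y" "mt y = Suc a" "ex y = ex a"
    unfolding matched_ok_def by blast
  then show "i < ex u \<and> mt u = Suc v" using ab by (auto simp: doubleton_eq_iff)
qed (use u in \<open>auto simp: matching_of_def\<close>)

lemma encode_mate_matching_of:
  assumes m: "matched_ok P n i ex mt" and u: "u < n"
  shows "encode_mate (mate (matching_of n i ex mt) u) = (if i < ex u then mt u else 0)"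
proof (cases "i < ex u")
  case True
  then obtain v where v: "mt u = Suc v" using m u unfolding matched_ok_def by blast
  then have "{u, x} \<in> matching_of n i ex mt \<longleftrightarrow> x = v" for x
    using matching_of_mate[OF m u] True by auto
  then show ?thesis using True v by (simp add: mate_def)
next
  case False
  then show ?thesis using matching_of_mate[OF m u] by (simp add: mate_def)
qed

lemma matching_of_eq:
  assumes m: "matched_ok P n i ex mt" and e: "e \<in> matching_of n i ex mt" "x \<in> e"
  shows "x < n \<and> i < ex x \<and> (\<exists>y. mt x = Suc y \<and> e = {x, y})"
proof -
  obtain a b where ab: "e = {a, b}" "a < n" "i < ex a" "mt a = Suc b"
    using e unfolding matching_of_def by blast
  with m obtain y where "y < n" "mt a = Suc y" "mt y = Suc a" "ex y = ex a"
    unfolding matched_ok_def by blast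
  then show ?thesis using ab e(2) by auto
qed

text \<open>An edge present at \<open>i\<close> is permanent in its block of width 1, so one of its
  end points is matched at \<open>i\<close>; in a strictly larger matching the additional edge would
  meet the matched edge at that point.\<close>

lemma maximal_matching_of:
  assumes inv: "level_inv P n K i 0 ex mt"
    and P: "\<And>e. e \<in> graph_at P i \<Longrightarrow> e \<subseteq> {..<n}"
  shows "maximal_matching (graph_at P i) (matching_of n i ex mt)"
proof -
  let ?M = "matching_of n i ex mt"
  have m: "matched_ok P n i ex mt" using inv by (simp add: level_inv_def)
  have "?M \<subseteq> graph_at P i"
  proof
    fix e assume "e \<in> ?M"
    then obtain a b where ab: "e = {a, b}" "a < n" "i < ex a" "mt a = Suc b"
      unfolding matching_of_def by blast
    with m obtain y where "mt a = Suc y" "\<forall>t\<in>{i..<ex a}. {a, y} \<in> graph_at P t"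
      unfolding matched_ok_def by blast
    then show "e \<in> graph_at P i" using ab by auto
  qed
  moreover have "pairwise disjnt ?M"
  proof (rule pairwiseI, rule ccontr)
    fix e f assume ef: "e \<in> ?M" "f \<in> ?M" "e \<noteq> f" "\<not> disjnt e f"
    then obtain x where "x \<in> e" "x \<in> f" unfolding disjnt_def by blast
    obtain y where "mt x = Suc y" "e = {x, y}"
      using matching_of_eq[OF m ef(1) \<open>x \<in> e\<close>] by blast
    moreover obtain z where "mt x = Suc z" "f = {x, z}"
      using matching_of_eq[OF m ef(2) \<open>x \<in> f\<close>] by blast
    ultimately show False using ef(3) by simp
  qed
  moreover have False if M': "matching (graph_at P i) M'" "?M \<subset> M'" for M'
  proof -
    obtain e where e: "e \<in> M'" "e \<notin> ?M" using M'(2) by blast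
    then have eG: "e \<in> graph_at P i" using M'(1) by (auto simp: matching_def)
    then have "e \<in> permanent P (2 ^ 0) i" by (simp add: permanent_def block_start_def)
    then have "covered ex e (block_start (2 ^ 0) i + 2 ^ 0)" using inv by (auto simp: level_inv_def)
    then obtain u where u: "u \<in> e" "i < ex u" unfolding covered_def block_start_def by auto
    have "u < n" using P[OF eG] u by auto
    then obtain v where "mt u = Suc v" using m u unfolding matched_ok_def by blast
    then have "{u, v} \<in> ?M" using matching_of_mate[OF m \<open>u < n\<close>] u by simp
    then have "{u, v} \<in> M'" "{u, v} \<noteq> e" using M'(2) e by auto
    then have "disjnt {u, v} e" using M'(1) e(1) unfolding matching_def by (metis pairwiseD)
    then show False using u by (simp add: disjnt_def)
  qed
  ultimately show ?thesis unfolding maximal_matching_def matching_def by blast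
qed

text \<open>
  \<open>next_del\<close>: \<open>d\<close> is the first time after \<open>t\<close> at which \<open>e\<close> is deleted, or \<open>I\<close> if there is none.
  \<open>lives_until\<close>: \<open>e\<close> is present from \<open>t\<close> on until just before \<open>d\<close>; any \<open>d \<le> t\<close> means that it
  is absent at \<open>t\<close>. Only comparisons of \<open>d\<close> with block ends \<open>b\<close> matter.
\<close>

definition deletes :: "op list \<Rightarrow> nat \<Rightarrow> edge \<Rightarrow> bool" where
  "deletes P t e \<longleftrightarrow> 1 \<le> t \<and> t \<le> length P \<and> op_edge (op_at P t) = e \<and> op_kind (op_at P t) = 2"

definition next_del :: "op list \<Rightarrow> nat \<Rightarrow> edge \<Rightarrow> nat \<Rightarrow> nat \<Rightarrow> bool" where
  "next_del P I e t d \<longleftrightarrow> d \<le> I \<and>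
     (\<forall>b. t < b \<and> b \<le> I \<longrightarrow> (b \<le> d \<longleftrightarrow> (\<forall>t'. t < t' \<and> t' < b \<longrightarrow> \<not> deletes P t' e)))"

definition lives_until :: "op list \<Rightarrow> nat \<Rightarrow> edge \<Rightarrow> nat \<Rightarrow> nat \<Rightarrow> bool" where
  "lives_until P I e t d \<longleftrightarrow> d \<le> I \<and>
     (\<forall>b. t < b \<and> b \<le> I \<longrightarrow> (b \<le> d \<longleftrightarrow> (\<forall>t'\<in>{t..<b}. e \<in> graph_at P t')))"

section \<open>Times of deletion and the lifetime of an edge\<close>

lemma next_del_end: "length P \<le> t \<Longrightarrow> next_del P I e t I"
  by (auto simp: next_del_def deletes_def)

lemma next_del_pred:
  assumes "next_del P I e (Suc x) d" "Suc x < I"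
  shows "next_del P I e x (if deletes P (Suc x) e then Suc x else d)"
proof (cases "deletes P (Suc x) e")
  case True
  have "b \<le> Suc x \<longleftrightarrow> (\<forall>t'. x < t' \<and> t' < b \<longrightarrow> \<not> deletes P t' e)" if "x < b" for b
  proof (cases "b \<le> Suc x")
    case False
    then show ?thesis using True by (auto intro: exI[of _ "Suc x"])
  qed (use that in auto)
  then show ?thesis using True assms(2) by (simp add: next_del_def)
next
  case False
  have d: "d \<le> I" "\<And>b. Suc x < b \<Longrightarrow> b \<le> I \<Longrightarrow> b \<le> d \<longleftrightarrow> (\<forall>t'. Suc x < t' \<and> t' < b \<longrightarrow> \<not> deletes P t' e)"
    using assms(1) by (auto simp: next_del_def)
  have "b \<le> d \<longleftrightarrow> (\<forall>t'. x < t' \<and> t' < b \<longrightarrow> \<not> deletes P t' e)" if b: "x < b" "b \<le> I" for b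
  proof (cases "b = Suc x")
    case True
    \<comment> \<open>For \<open>b = Suc (Suc x)\<close> the range of the quantifier is empty, so
      the equivalence yields this bound; \<open>Suc x < I\<close> makes that \<open>b\<close>
      admissible.\<close>
    have "Suc (Suc x) \<le> d" using d(2)[of "Suc (Suc x)"] assms(2) by auto
    then show ?thesis using True by auto
  next
    case neq: False
    then have "b \<le> d \<longleftrightarrow> (\<forall>t'. Suc x < t' \<and> t' < b \<longrightarrow> \<not> deletes P t' e)" using d(2) b by simp
    then show ?thesis using False by (metis Suc_lessI Suc_lessD)
  qed
  then show ?thesis using False d(1) by (simp add: next_del_def)
qed

lemma deletes_iff:
  assumes "1 \<le> t"
  shows "e \<in> graph_at P (t - 1) \<Longrightarrow> e \<in> graph_at P t \<longleftrightarrow> \<not> deletes P t e"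
  using assms op_kind_cases[of "op_at P t"] by (auto simp: graph_at_step_iff[OF assms] deletes_def)

text \<open>A present edge is lost only through a deletion, and insertions of it in between are
  harmless. So the next deletion time, known by lookahead, is the end of its life.\<close>

lemma lives_until_insert:
  assumes "next_del P I e t d" "e \<in> graph_at P t"
  shows "lives_until P I e t d"
proof -
  have "(\<forall>t'\<in>{t..<b}. e \<in> graph_at P t') \<longleftrightarrow> (\<forall>t'. t < t' \<and> t' < b \<longrightarrow> \<not> deletes P t' e)" for b
  proof
    assume *: "\<forall>t'\<in>{t..<b}. e \<in> graph_at P t'"
    show "\<forall>t'. t < t' \<and> t' < b \<longrightarrow> \<not> deletes P t' e"
    proof (intro allI impI)
      fix t' assume "t < t' \<and> t' < b"
      then have "t' \<in> {t..<b}" "t' - 1 \<in> {t..<b}" "1 \<le> t'" by auto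
      then show "\<not> deletes P t' e" using * deletes_iff[of t' e P] by blast
    qed
  next
    assume *: "\<forall>t'. t < t' \<and> t' < b \<longrightarrow> \<not> deletes P t' e"
    have "e \<in> graph_at P (t + k)" if "t + k < b" for k
      using that
    proof (induction k)
      case (Suc k)
      then show ?case using * deletes_iff[of "t + Suc k" e P] by auto
    qed (use assms in simp)
    then show "\<forall>t'\<in>{t..<b}. e \<in> graph_at P t'" by (metis atLeastLessThan_iff le_add_diff_inverse)
  qed
  then show ?thesis using assms by (simp add: next_del_def lives_until_def)
qed

text \<open>A deletion calls for no new value: the stored time is then no later than the deletion,
  which already means absent. So a time step has to write only when it inserts.\<close>

lemma lives_until_next:
  assumes "lives_until P I e t d" "\<not> (Suc t \<le> length P \<and> op_edge (op_at P (Suc t)) = e \<and> op_kind (op_at P (Suc t)) = 1)"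
  shows "lives_until P I e (Suc t) d"
proof -
  have "e \<in> graph_at P (Suc t) \<Longrightarrow> e \<in> graph_at P t"
    using assms(2) by (simp add: graph_at_step_iff[of "Suc t"] split: if_splits)
  then have "(\<forall>t'\<in>{Suc t..<b}. e \<in> graph_at P t') \<longleftrightarrow> (\<forall>t'\<in>{t..<b}. e \<in> graph_at P t')" if "Suc t < b" for b
  proof -
    have "{t..<b} = insert t {Suc t..<b}" using that by auto
    then show ?thesis using \<open>e \<in> graph_at P (Suc t) \<Longrightarrow> e \<in> graph_at P t\<close> that by auto
  qed
  then show ?thesis using assms(1) by (simp add: lives_until_def)
qed

lemma lives_until_0: "lives_until P I e 0 0"
  by (auto simp: lives_until_def intro: bexI[of _ 0])

text \<open>After the last entry nothing changes any more, so the edges that survive the phase can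
  be recognised in chunk 6 by the value \<open>never n\<close>.\<close>

lemma lives_until_end:
  assumes "lives_until P I e (length P) d" "length P < I"
  shows "d = I \<longleftrightarrow> e \<in> graph_at P (length P)"
proof -
  have "I \<le> d \<longleftrightarrow> (\<forall>t'\<in>{length P..<I}. e \<in> graph_at P t')" "d \<le> I"
    using assms by (auto simp: lives_until_def)
  moreover have "(\<forall>t'\<in>{length P..<I}. e \<in> graph_at P t') \<longleftrightarrow> e \<in> graph_at P (length P)"
    using graph_at_beyond[of P] assms(2) by (metis atLeastLessThan_iff le_refl)
  ultimately show ?thesis by linarith
qed

section \<open>Processing one time step\<close>

text \<open>
  Registers: 2 is the time within the phase, 3 the number of entries, 4 the largest block width,
  5 the infinite deletion time, 6 the target time, 7 to 12 are scratch. Chunks: 2, 3, 4 hold the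
  end points and kinds of the entries, 5 their next deletion times, 6 the time until which an edge
  stays present, 7 is used to compute chunk 5, 8 holds the time until which a vertex stays
  matched, 9 its mate plus one.
\<close>

definition never :: "nat \<Rightarrow> nat" where
  "never n = 2 * (n * n) + 2"

definition geometry :: "nat \<Rightarrow> state \<Rightarrow> bool" where
  "geometry n s \<longleftrightarrow>
     rows s 2 = 1 \<and> rows s 3 = 1 \<and> rows s 4 = 1 \<and> rows s 5 = 1 \<and>
     cols s 2 = n * n + 1 \<and> cols s 3 = n * n + 1 \<and> cols s 4 = n * n + 1 \<and> cols s 5 = n * n + 1 \<and>
     rows s 6 = n \<and> rows s 7 = n \<and> cols s 6 = n \<and> cols s 7 = n \<and>
     rows s 8 = 1 \<and> rows s 9 = 1 \<and> cols s 8 = n \<and> cols s 9 = n"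

definition stored :: "op list \<Rightarrow> nat \<Rightarrow> state \<Rightarrow> bool" where
  "stored P t s \<longleftrightarrow> cell s 2 0 t = op_fst (op_at P t) \<and> cell s 3 0 t = op_snd (op_at P t) \<and>
     cell s 4 0 t = op_kind (op_at P t)"

text \<open>Storing the smaller end point first gives each edge exactly one position in the
  two-dimensional chunks.\<close>

definition normal_ops :: "nat \<Rightarrow> op list \<Rightarrow> bool" where
  "normal_ops n P \<longleftrightarrow> (\<forall>q\<in>set P. op_fst q < op_snd q \<and> op_snd q < n)"

text \<open>\<open>2 ^ K\<close> agrees with \<open>length P\<close> up to a factor of about 2:
  large enough that the parent of a widest block starts at time 0, small enough that
  \<open>K\<close> is logarithmic. The summand 1 admits the empty phase with
  \<open>K = 0\<close>.\<close>

definition phase_inv :: "nat \<Rightarrow> nat \<Rightarrow> op list \<Rightarrow> state \<Rightarrow> bool" where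
  "phase_inv n K P s \<longleftrightarrow> geometry n s \<and> normal_ops n P \<and>
     length P \<le> n * n \<and> length P < 2 * 2 ^ K \<and> 2 ^ K \<le> length P + 1 \<and>
     reg s 3 = length P \<and> reg s 4 = 2 ^ K \<and> reg s 5 = never n \<and>
     (\<forall>t. 1 \<le> t \<and> t \<le> length P \<longrightarrow> stored P t s \<and>
        next_del P (never n) (op_edge (op_at P t)) t (cell s 5 0 t))"

definition time_inv :: "nat \<Rightarrow> op list \<Rightarrow> nat \<Rightarrow> state \<Rightarrow> bool" where
  "time_inv n P i s \<longleftrightarrow> reg s 2 = i \<and> i \<le> length P \<and>
     (\<forall>t. 1 \<le> t \<and> t \<le> length P \<longrightarrow>
        lives_until P (never n) (op_edge (op_at P t)) i (cell s 6 (op_fst (op_at P t)) (op_snd (op_at P t))))"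

lemma phase_inv_cong:
  assumes "phase_inv n K P s" "rows s' = rows s" "cols s' = cols s"
    "reg s' 3 = reg s 3" "reg s' 4 = reg s 4" "reg s' 5 = reg s 5"
    "cell s' 2 = cell s 2" "cell s' 3 = cell s 3" "cell s' 4 = cell s 4" "cell s' 5 = cell s 5"
  shows "phase_inv n K P s'"
  using assms unfolding phase_inv_def geometry_def stored_def by simp

lemma time_inv_cong:
  assumes "time_inv n P i s" "reg s' 2 = reg s 2" "cell s' 6 = cell s 6"
  shows "time_inv n P i s'"
  using assms unfolding time_inv_def by simp

lemma normal_ops_at:
  assumes "normal_ops n P" "1 \<le> t" "t \<le> length P"
  shows "op_fst (op_at P t) < op_snd (op_at P t)" "op_snd (op_at P t) < n"
proof -
  have "op_at P t \<in> set P" using assms by (simp add: op_at_def)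
  then show "op_fst (op_at P t) < op_snd (op_at P t)" "op_snd (op_at P t) < n"
    using assms(1) unfolding normal_ops_def by auto
qed

section \<open>The programs for one time step\<close>

definition candidate_body :: com where
  "candidate_body =
     Seq (Assign 7 (Add (Reg 7) (Const 1)))
    (Seq (Assign 9 (Cell 2 (Const 0) (Reg 7)))
    (Seq (Assign 10 (Cell 3 (Const 0) (Reg 7)))
      (If (Conj (Neg (Less (Cell 6 (Reg 9) (Reg 10)) (Add (Reg 2) (Reg 11))))
            (Conj (Neg (Less (Reg 2) (Cell 8 (Const 0) (Reg 9))))
                  (Neg (Less (Reg 2) (Cell 8 (Const 0) (Reg 10))))))
        (Seq (Store 8 (Const 0) (Reg 9) (Add (Reg 2) (Reg 11)))
        (Seq (Store 8 (Const 0) (Reg 10) (Add (Reg 2) (Reg 11)))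
        (Seq (Store 9 (Const 0) (Reg 9) (Add (Reg 10) (Const 1)))
             (Store 9 (Const 0) (Reg 10) (Add (Reg 9) (Const 1))))))
        Skip)))"

definition candidate_loop :: com where
  "candidate_loop =
     While (Conj (Less (Reg 7) (Reg 3)) (Less (Add (Reg 7) (Const 1)) (Reg 8))) candidate_body"

definition level_loop :: com where
  "level_loop =
     While (Less (Const 0) (Reg 11))
       (Seq (If (Equal (Mod (Reg 2) (Reg 11)) (Const 0))
              (Seq (Assign 7 (Sub (Reg 2) (Mod (Reg 2) (Mul (Const 2) (Reg 11)))))
              (Seq (Assign 8 (Add (Reg 7) (Mul (Const 2) (Reg 11))))
                candidate_loop))
              Skip)
         (Assign 11 (Div (Reg 11) (Const 2))))"

definition step_prog :: com where
  "step_prog =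
     Seq (If (Equal (Cell 4 (Const 0) (Reg 2)) (Const 1))
           (Store 6 (Cell 2 (Const 0) (Reg 2)) (Cell 3 (Const 0) (Reg 2)) (Cell 5 (Const 0) (Reg 2)))
           Skip)
     (Seq (Assign 11 (Reg 4)) level_loop)"

definition advance_prog :: com where
  "advance_prog = While (Less (Reg 2) (Reg 6)) (Seq (Assign 2 (Add (Reg 2) (Const 1))) step_prog)"

text \<open>For each of at most \<open>2 * w\<close> entries of the parent the candidate loop takes
  at most 9 steps, its test included, which makes 18 per unit of width. The 6 steps are two loop
  tests, the branch, two assignments and the halving of the width.\<close>

fun level_cost :: "nat \<Rightarrow> nat \<Rightarrow> nat" where
  "level_cost t w = (if w = 0 then 0
     else 6 + (if w dvd t then 18 * w else 0) + level_cost t (w div 2))"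

declare level_cost.simps [simp del]

text \<open>Times are at most \<open>n * n\<close> and widths at most \<open>n * n + 1\<close>, so
  under this bound the arithmetic of the programs never wraps around.\<close>

locale ram =
  fixes N :: machine and n :: nat
  assumes word_bound_ge: "8 * (n * n) + 16 \<le> word_bound N"
begin

section \<open>Verification of one time step\<close>

definition candidate_inv :: "op list \<Rightarrow> nat \<Rightarrow> nat \<Rightarrow> nat \<Rightarrow> state \<Rightarrow> bool" where
  "candidate_inv P K i w s \<longleftrightarrow>
     phase_inv n K P s \<and> time_inv n P i s \<and> level_inv P n K i w (cell s 8 0) (cell s 9 0) \<and>
     reg s 11 = w \<and> reg s 8 = block_start (2 * w) i + 2 * w \<and> block_start (2 * w) i \<le> reg s 7 \<and>
     (\<forall>t. block_start (2 * w) i < t \<and> t \<le> reg s 7 \<and> t \<le> length P \<and>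
        op_edge (op_at P t) \<in> permanent P w i \<longrightarrow>
        covered (cell s 8 0) (op_edge (op_at P t)) (i + w))"

lemma candidate_loop:
  assumes "candidate_inv P K i w s" and w: "w = 2 ^ j" "j \<le> K" "w dvd i" "1 \<le> i"
  shows "wp N win candidate_loop s (\<lambda>t s'. candidate_inv P K i w s' \<and>
     \<not> (reg s' 7 < length P \<and> reg s' 7 + 1 < block_start (2 * w) i + 2 * w) \<and>
     t \<le> 9 * (reg s 8 - reg s 7) + 1)"
proof -
  have wK: "w \<le> 2 ^ K" using w by simp
  have lim: "i + w < word_bound N" "reg s 7 + 1 < word_bound N" if "candidate_inv P K i w s" "reg s 7 < reg s 3" for s
    using that wK word_bound_ge unfolding candidate_inv_def phase_inv_def time_inv_def by linarith+
  show ?thesis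
    unfolding candidate_loop_def
  proof (rule wp_conseq[OF wp_While[where I = "candidate_inv P K i w" and f = "\<lambda>s. 9 * (reg s 8 - reg s 7)"]])
    fix s assume I: "candidate_inv P K i w s" and
      b: "holds N win s (Conj (Less (Reg 7) (Reg 3)) (Less (Add (Reg 7) (Const 1)) (Reg 8)))"
    define t where "t = reg s 7 + 1"
    have W: "1 < word_bound N" using word_bound_ge by linarith
    have inv: "phase_inv n K P s" "time_inv n P i s" "level_inv P n K i w (cell s 8 0) (cell s 9 0)"
      and regs: "reg s 11 = w" "reg s 8 = block_start (2 * w) i + 2 * w" "reg s 2 = i" "reg s 3 = length P"
      and p: "block_start (2 * w) i \<le> reg s 7"
      and geo: "geometry n s"
      and cov: "\<And>t. block_start (2 * w) i < t \<Longrightarrow> t \<le> reg s 7 \<Longrightarrow> t \<le> length P \<Longrightarrow>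
        op_edge (op_at P t) \<in> permanent P w i \<Longrightarrow> covered (cell s 8 0) (op_edge (op_at P t)) (i + w)"
      and nn: "length P \<le> n * n"
      using I unfolding candidate_inv_def phase_inv_def time_inv_def by auto
    have lt: "reg s 7 < reg s 3" using b by simp
    note lim = lim[OF I lt]
    have t: "1 \<le> t" "t \<le> length P" "t < block_start (2 * w) i + 2 * w" "t < word_bound N" "t \<le> n * n"
      using b lim W regs nn by (auto simp: t_def)
    define u v where "u = op_fst (op_at P t)" and "v = op_snd (op_at P t)"
    have uv: "u < v" "v < n" "u < n"
      using normal_ops_at[of n P t] t inv(1) unfolding u_def v_def phase_inv_def by auto
    have cells: "cell s 2 0 t = u" "cell s 3 0 t = v"
      using inv(1) t unfolding phase_inv_def stored_def u_def v_def by auto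
    have live: "lives_until P (never n) {u, v} i (cell s 6 u v)"
      using inv(2) t unfolding time_inv_def u_def v_def by auto
    \<comment> \<open>From \<open>i \<le> n * n\<close> and \<open>w \<le> n * n + 1\<close>. This
      is where the size of \<open>never n\<close> comes from: no block end may exceed it.\<close>
    have iw: "i < i + w" "i + w \<le> never n"
      using w wK nn inv unfolding never_def phase_inv_def time_inv_def by (simp, linarith)
    \<comment> \<open>Chunk 6 holds the time until which the edge lives, so a single comparison
      decides whether it is present throughout the block.\<close>
    have pres: "i + w \<le> cell s 6 u v \<longleftrightarrow> {u, v} \<in> permanent P w i"
      using live iw w(3) unfolding lives_until_def permanent_def by (simp add: block_start_dvd)
    have vW: "v + 1 < word_bound N" "u + 1 < word_bound N"
      using uv word_bound_ge le_square[of n] by linarith+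
    let ?free = "i + w \<le> cell s 6 u v \<and> cell s 8 0 u \<le> i \<and> cell s 8 0 v \<le> i"
    let ?s1 = "s\<lparr>reg := (reg s)(7 := t, 9 := u, 10 := v)\<rparr>"
    let ?s2 = "store 9 0 v (u + 1) (store 9 0 u (v + 1) (store 8 0 v (i + w) (store 8 0 u (i + w) ?s1)))"
    have step: "wp N win candidate_body s Q \<longleftrightarrow> (if ?free then Q 8 ?s2 else Q 5 ?s1)" for Q
      using geo regs t uv cells lim vW W
      by (simp add: candidate_body_def wp_simps Let_def in_bounds_def geometry_def t_def[symmetric] not_less del: One_nat_def)
    have c1: "candidate_inv P K i w ?s1" if "\<not> ?free"
    proof -
      have "covered (cell s 8 0) {u, v} (i + w)" if "{u, v} \<in> permanent P w i"
      proof -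
        have "\<exists>x\<in>{u, v}. i < cell s 8 0 x" using \<open>\<not> ?free\<close> pres that by auto
        then obtain x where x: "x \<in> {u, v}" "i < cell s 8 0 x" by blast
        \<comment> \<open>An end point that is matched beyond \<open>i\<close> stays matched to the
          end of the block, because the invariant holds for all widths up to \<open>w\<close>
          itself.\<close>
        then have "i + w \<le> cell s 8 0 x" using inv(3) uv w unfolding level_inv_def by blast
        then show ?thesis using x unfolding covered_def by blast
      qed
      then show ?thesis using inv regs p cov
        unfolding candidate_inv_def
        by (auto simp: le_Suc_eq t_def u_def v_def intro: phase_inv_cong time_inv_cong)
    qed
    have c2: "candidate_inv P K i w ?s2" if ?free
    proof -
      have "level_inv P n K i w (cell ?s2 8 0) (cell ?s2 9 0)"
      proof (rule level_inv_match[OF inv(3) w(1,3)])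
        show "{u, v} \<in> graph_at P t" if "i \<le> t" "t < i + w" for t
          using \<open>?free\<close> pres that w(3) by (auto simp: permanent_def block_start_dvd)
      qed (use uv that t geo in \<open>auto simp: u_def v_def in_bounds_def geometry_def\<close>)
      moreover have "covered (cell ?s2 8 0) e (i + w)" if "covered (cell s 8 0) e (i + w)" for e
        by (rule covered_mono[OF that]) (use \<open>?free\<close> iw in auto)
      moreover have "covered (cell ?s2 8 0) {u, v} (i + w)"
        using uv geo unfolding covered_def by (auto simp: in_bounds_def geometry_def)
      moreover have "phase_inv n K P ?s2" by (rule phase_inv_cong[OF inv(1)]) auto
      moreover have "time_inv n P i ?s2" by (rule time_inv_cong[OF inv(2)]) auto
      ultimately show ?thesis using regs p cov
        unfolding candidate_inv_def by (auto simp: le_Suc_eq t_def u_def v_def simp del: store_simps(4))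
    qed
    have "9 * (reg s 8 - reg s 7) = 9 + 9 * (reg s 8 - t)" using t regs by (simp add: t_def)
    then show "wp N win candidate_body s (\<lambda>t s'. candidate_inv P K i w s' \<and> 1 + t + 9 * (reg s' 8 - reg s' 7) \<le> 9 * (reg s 8 - reg s 7))"
      unfolding step using c1 c2 by auto
  next
    show "candidate_inv P K i w s" by fact
  next
    fix t s' assume *: "candidate_inv P K i w s' \<and>
      \<not> holds N win s' (Conj (Less (Reg 7) (Reg 3)) (Less (Add (Reg 7) (Const 1)) (Reg 8))) \<and>
      t + 9 * (reg s' 8 - reg s' 7) \<le> 9 * (reg s 8 - reg s 7) + 1"
    have "reg s' 8 = block_start (2 * w) i + 2 * w" "reg s' 3 = length P"
      using * unfolding candidate_inv_def phase_inv_def by auto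
    moreover have "1 < word_bound N" using word_bound_ge by linarith
    ultimately show "candidate_inv P K i w s' \<and>
       \<not> (reg s' 7 < length P \<and> reg s' 7 + 1 < block_start (2 * w) i + 2 * w) \<and>
       t \<le> 9 * (reg s 8 - reg s 7) + 1"
      using * lim(2)[of s'] by auto
  qed
qed

definition level_loop_inv :: "op list \<Rightarrow> nat \<Rightarrow> nat \<Rightarrow> state \<Rightarrow> bool" where
  "level_loop_inv P K i s \<longleftrightarrow>
     phase_inv n K P s \<and> time_inv n P i s \<and> level_inv P n K i (reg s 11) (cell s 8 0) (cell s 9 0) \<and>
     (reg s 11 = 0 \<or> (\<exists>j\<le>K. reg s 11 = 2 ^ j))"

lemma pow2_half: "(2::nat) ^ j div 2 = 0 \<or> (\<exists>l\<le>j. 2 ^ j div 2 = (2::nat) ^ l)"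
  by (cases j) (auto intro: exI[of _ "j - 1"])

lemma level_loop:
  assumes "level_loop_inv P K i s" and i: "1 \<le> i"
  shows "wp N win level_loop s (\<lambda>t s'. level_loop_inv P K i s' \<and> reg s' 11 = 0 \<and>
     t \<le> level_cost i (reg s 11) + 1)"
  unfolding level_loop_def
proof (rule wp_conseq[OF wp_While[where I = "level_loop_inv P K i" and f = "\<lambda>s. level_cost i (reg s 11)"]])
  fix s assume I: "level_loop_inv P K i s" and b: "holds N win s (Less (Const 0) (Reg 11))"
  have W: "2 < word_bound N" using word_bound_ge by linarith
  have b: "0 < reg s 11" using b W by simp
  have inv: "phase_inv n K P s" "time_inv n P i s" "level_inv P n K i (reg s 11) (cell s 8 0) (cell s 9 0)"
    using I unfolding level_loop_inv_def by auto
  obtain j where j: "j \<le> K" "reg s 11 = 2 ^ j" using I b unfolding level_loop_inv_def by auto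
  have jK: "2 ^ j \<le> (2::nat) ^ K" using j by simp
  have regs: "reg s 2 = i" "reg s 3 = length P" "i \<le> length P" "length P < 2 * 2 ^ K"
    using inv unfolding phase_inv_def time_inv_def by auto
  have bounds: "2 * 2 ^ j < word_bound N" "block_start (2 * 2 ^ j) i + 2 * 2 ^ j < word_bound N"
    using inv jK word_bound_ge block_start_le[of "2 * 2 ^ j" i]
    unfolding phase_inv_def time_inv_def by linarith+
  have half: "2 ^ j div 2 = (0::nat) \<or> (\<exists>l\<le>K. 2 ^ j div 2 = (2::nat) ^ l)"
    using pow2_half[of j] j(1) le_trans by blast
  show "wp N win
     (Seq (If (Equal (Mod (Reg 2) (Reg 11)) (Const 0))
            (Seq (Assign 7 (Sub (Reg 2) (Mod (Reg 2) (Mul (Const 2) (Reg 11)))))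
            (Seq (Assign 8 (Add (Reg 7) (Mul (Const 2) (Reg 11))))
              candidate_loop))
            Skip)
       (Assign 11 (Div (Reg 11) (Const 2)))) s
     (\<lambda>t s'. level_loop_inv P K i s' \<and> 1 + t + level_cost i (reg s' 11) \<le> level_cost i (reg s 11))"
  proof (cases "2 ^ j dvd i")
    case False
    then have "i mod 2 ^ j \<noteq> 0" by (simp add: dvd_eq_mod_eq_0)
    moreover have "level_inv P n K i (2 ^ j div 2) (cell s 8 0) (cell s 9 0)"
      using level_inv_skip False inv(3) j by simp
    then have "level_loop_inv P K i (s\<lparr>reg := (reg s)(11 := 2 ^ j div 2)\<rparr>)"
      using inv half unfolding level_loop_inv_def
      by (auto intro: phase_inv_cong[OF inv(1)] time_inv_cong[OF inv(2)])
    moreover have "level_cost i (2 ^ j) = 6 + level_cost i (2 ^ j div 2)"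
      using False by (subst level_cost.simps) simp
    ultimately show ?thesis
      using j regs W by (simp add: wp_simps)
  next
    case True
    let ?p = "block_start (2 * 2 ^ j) i"
    let ?s = "s\<lparr>reg := (reg s)(7 := ?p, 8 := ?p + 2 * 2 ^ j)\<rparr>"
    have "candidate_inv P K i (2 ^ j) ?s"
      using inv j unfolding candidate_inv_def
      by (auto intro: phase_inv_cong[OF inv(1)] time_inv_cong[OF inv(2)])
    from candidate_loop[OF this refl j(1) True i]
    have loop: "wp N win candidate_loop ?s (\<lambda>t s'. candidate_inv P K i (2 ^ j) s' \<and>
       \<not> (reg s' 7 < length P \<and> reg s' 7 + 1 < ?p + 2 * 2 ^ j) \<and> t \<le> 18 * 2 ^ j + 1)" by simp
    have cost: "level_cost i (2 ^ j) = 6 + 18 * 2 ^ j + level_cost i (2 ^ j div 2)"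
      using True by (subst level_cost.simps) simp
    have "wp N win candidate_loop ?s (\<lambda>t s'.
       level_loop_inv P K i (s'\<lparr>reg := (reg s')(11 := reg s' 11 div 2)\<rparr>) \<and>
       t \<le> 18 * 2 ^ j + 1 \<and> reg s' 11 = 2 ^ j)"
    proof (rule wp_conseq[OF loop], elim conjE)
      fix t s'
      assume c: "candidate_inv P K i (2 ^ j) s'" "t \<le> 18 * 2 ^ j + 1"
        and stop: "\<not> (reg s' 7 < length P \<and> reg s' 7 + 1 < ?p + 2 * 2 ^ j)"
      have inv': "phase_inv n K P s'" "time_inv n P i s'"
        "level_inv P n K i (2 ^ j) (cell s' 8 0) (cell s' 9 0)" "reg s' 11 = 2 ^ j"
        using c(1) unfolding candidate_inv_def by auto
      have "level_inv P n K i (2 ^ j div 2) (cell s' 8 0) (cell s' 9 0)"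
      proof (rule level_inv_done[OF inv'(3) j(1) True regs(4,3)])
        fix t' assume "?p < t'" "t' < ?p + 2 * 2 ^ j" "t' \<le> length P"
          "op_edge (op_at P t') \<in> permanent P (2 ^ j) i"
        moreover from this have "t' \<le> reg s' 7" using stop by linarith
        ultimately show "covered (cell s' 8 0) (op_edge (op_at P t')) (i + 2 ^ j)"
          using c(1) unfolding candidate_inv_def by blast
      qed
      then show "level_loop_inv P K i (s'\<lparr>reg := (reg s')(11 := reg s' 11 div 2)\<rparr>) \<and>
         t \<le> 18 * 2 ^ j + 1 \<and> reg s' 11 = 2 ^ j"
        using inv' half c(2) unfolding level_loop_inv_def
        by (auto intro: phase_inv_cong[OF inv'(1)] time_inv_cong[OF inv'(2)])
    qed
    then have "wp N win candidate_loop ?s (\<lambda>t s'.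
       level_loop_inv P K i (s'\<lparr>reg := (reg s')(11 := reg s' 11 div 2)\<rparr>) \<and>
       1 + (1 + (1 + (1 + t)) + 1) + level_cost i (reg s' 11 div 2) \<le> level_cost i (2 ^ j))"
      by (rule wp_conseq) (use cost in auto)
    moreover have "i - i mod (2 * 2 ^ j) = ?p" by (simp add: block_start_def)
    moreover have "i mod 2 ^ j = 0" using True by auto
    ultimately show ?thesis
      using j regs W bounds by (simp add: wp_simps fun_upd_def[symmetric])
  qed
next
  show "level_loop_inv P K i s" by fact
next
  fix t s'
  assume "level_loop_inv P K i s' \<and> \<not> holds N win s' (Less (Const 0) (Reg 11)) \<and>
    t + level_cost i (reg s' 11) \<le> level_cost i (reg s 11) + 1"
  then show "level_loop_inv P K i s' \<and> reg s' 11 = 0 \<and> t \<le> level_cost i (reg s 11) + 1"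
    using word_bound_ge by auto
qed

definition settled :: "op list \<Rightarrow> nat \<Rightarrow> nat \<Rightarrow> state \<Rightarrow> bool" where
  "settled P K i s \<longleftrightarrow> phase_inv n K P s \<and> time_inv n P i s \<and>
     level_inv P n K i 0 (cell s 8 0) (cell s 9 0)"

lemma step_prog:
  assumes "settled P K i s" and i: "i < length P"
  shows "wp N win step_prog (s\<lparr>reg := (reg s)(2 := Suc i)\<rparr>)
     (\<lambda>t s'. settled P K (Suc i) s' \<and> t \<le> level_cost (Suc i) (2 ^ K) + 4)"
proof -
  let ?i = "Suc i"
  let ?q = "op_at P ?i"
  let ?u = "op_fst ?q" and ?v = "op_snd ?q"
  let ?s = "s\<lparr>reg := (reg s)(2 := ?i)\<rparr>"
  let ?s1 = "if op_kind ?q = 1 then store 6 ?u ?v (cell s 5 0 ?i) ?s else ?s"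
  let ?s2 = "?s1\<lparr>reg := (reg ?s1)(11 := 2 ^ K)\<rparr>"
  have inv: "phase_inv n K P s" "time_inv n P i s" "level_inv P n K i 0 (cell s 8 0) (cell s 9 0)"
    using assms unfolding settled_def by auto
  have W: "1 < word_bound N" using word_bound_ge by linarith
  have nn: "?i \<le> n * n" "never n > ?i" using inv(1) i unfolding phase_inv_def never_def by auto
  have cells: "cell s 2 0 ?i = ?u" "cell s 3 0 ?i = ?v" "cell s 4 0 ?i = op_kind ?q" "reg s 4 = 2 ^ K"
    and geo: "geometry n s"
    and nd: "next_del P (never n) (op_edge ?q) ?i (cell s 5 0 ?i)"
    using inv(1) i unfolding phase_inv_def stored_def by auto
  have norm: "normal_ops n P" using inv(1) unfolding phase_inv_def by simp
  have uv: "?u < ?v" "?v < n" using normal_ops_at[OF norm, of ?i] i by auto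
  have p: "phase_inv n K P ?s2" by (rule phase_inv_cong[OF inv(1)]) auto
  have "lives_until P (never n) (op_edge (op_at P t)) ?i (cell ?s2 6 (op_fst (op_at P t)) (op_snd (op_at P t)))"
    if t: "1 \<le> t" "t \<le> length P" for t
  proof (cases "op_kind ?q = 1 \<and> op_edge (op_at P t) = op_edge ?q")
    case True
    moreover have "op_fst (op_at P t) < op_snd (op_at P t)" using normal_ops_at[OF norm t] by simp
    \<comment> \<open>In normal form equal edges have equal end points in order, so every entry
      naming this edge reads the position that was just written.\<close>
    ultimately have "op_fst (op_at P t) = ?u" "op_snd (op_at P t) = ?v"
      using uv by (auto simp: doubleton_eq_iff)
    moreover have "op_edge ?q \<in> graph_at P ?i" using True i by (subst graph_at_step_iff) auto
    ultimately show ?thesis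
      using True uv geo lives_until_insert[OF nd] by (simp add: in_bounds_def geometry_def)
  next
    case False
    have "lives_until P (never n) (op_edge (op_at P t)) i (cell s 6 (op_fst (op_at P t)) (op_snd (op_at P t)))"
      using inv(2) t unfolding time_inv_def by blast
    moreover have "cell ?s2 6 (op_fst (op_at P t)) (op_snd (op_at P t)) =
      cell s 6 (op_fst (op_at P t)) (op_snd (op_at P t))" using False by auto
    ultimately show ?thesis using lives_until_next False by metis
  qed
  then have "time_inv n P ?i ?s2" using i unfolding time_inv_def by simp
  moreover have "level_inv P n K ?i (2 ^ K) (cell ?s2 8 0) (cell ?s2 9 0)"
    using level_inv_next[OF inv(3)] by simp
  ultimately have "level_loop_inv P K ?i ?s2" using p unfolding level_loop_inv_def by auto
  from level_loop[OF this]
  have "wp N win level_loop ?s2 (\<lambda>t s'. level_loop_inv P K ?i s' \<and> reg s' 11 = 0 \<and>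
     t \<le> level_cost ?i (2 ^ K) + 1)" by simp
  then have loop: "wp N win level_loop ?s2 (\<lambda>t s'. settled P K ?i s' \<and>
     t + 3 \<le> level_cost ?i (2 ^ K) + 4)"
    by (rule wp_conseq) (auto simp: level_loop_inv_def settled_def)
  show ?thesis
  proof (cases "op_kind ?q = 1")
    case True
    then show ?thesis
      using loop cells geo nn(1) W unfolding step_prog_def
      by (simp add: wp_simps in_bounds_def geometry_def Let_def)
  next
    case False
    then show ?thesis
      using loop cells geo nn(1) W unfolding step_prog_def
      by (simp add: wp_simps in_bounds_def geometry_def Let_def)
  qed
qed

text \<open>The summand 6 consists of the 4 extra steps of \<open>step_prog\<close>, the increment
  of the time and the loop test. The target may lie far ahead: at the start of a phase one call
  passes through all replayed insertions.\<close>

lemma advance_prog: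
  assumes "settled P K i s" "i \<le> reg s 6" "reg s 6 \<le> length P"
  shows "wp N win advance_prog s (\<lambda>t s'. settled P K (reg s 6) s' \<and>
     t \<le> (\<Sum>x\<in>{i<..reg s 6}. level_cost x (2 ^ K) + 6) + 1)"
proof -
  define T where "T = reg s 6"
  define f where "f = (\<lambda>s :: state. \<Sum>x\<in>{reg s 2<..T}. level_cost x (2 ^ K) + 6)"
  let ?I = "\<lambda>s :: state. reg s 6 = T \<and> reg s 2 \<le> T \<and> settled P K (reg s 2) s"
  have reg2: "reg s 2 = i" if "settled P K i s" for s i
    using that unfolding settled_def time_inv_def by simp
  show ?thesis
    unfolding advance_prog_def
  proof (rule wp_conseq[OF wp_While[where I = ?I and f = f]])
    fix s' assume I: "?I s'" and b: "holds N win s' (Less (Reg 2) (Reg 6))"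
    define k where "k = reg s' 2"
    have k: "k < T" "k < length P" using I b assms(3) by (auto simp: T_def k_def)
    have "length P \<le> n * n" using assms(1) unfolding settled_def phase_inv_def by simp
    then have kW: "Suc k < word_bound N" "1 < word_bound N" using k word_bound_ge by linarith+
    have "settled P K k s'" using I by (simp add: k_def)
    from step_prog[OF this k(2)] have "wp N win step_prog (s'\<lparr>reg := (reg s')(2 := Suc k)\<rparr>)
       (\<lambda>t s'. ?I s' \<and> 2 + t + f s' \<le> (level_cost (Suc k) (2 ^ K) + 6) + (\<Sum>x\<in>{Suc k<..T}. level_cost x (2 ^ K) + 6))"
    proof (rule wp_conseq)
      fix t s''
      assume e: "exec N win step_prog (s'\<lparr>reg := (reg s')(2 := Suc k)\<rparr>) t s''"
        and *: "settled P K (Suc k) s'' \<and> t \<le> level_cost (Suc k) (2 ^ K) + 4"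
      have "reg s'' 6 = T"
        using exec_reg[OF e, of 6] I
        by (simp add: step_prog_def level_loop_def candidate_loop_def candidate_body_def)
      then show "?I s'' \<and> 2 + t + f s'' \<le> (level_cost (Suc k) (2 ^ K) + 6) + (\<Sum>x\<in>{Suc k<..T}. level_cost x (2 ^ K) + 6)"
        using * reg2[of "Suc k" s''] k by (simp add: f_def)
    qed
    moreover have "{k<..T} = insert (Suc k) {Suc k<..T}" using k by auto
    then have "f s' = (level_cost (Suc k) (2 ^ K) + 6) + (\<Sum>x\<in>{Suc k<..T}. level_cost x (2 ^ K) + 6)"
      by (simp add: f_def k_def[symmetric])
    ultimately show "wp N win (Seq (Assign 2 (Add (Reg 2) (Const 1))) step_prog) s'
      (\<lambda>t s''. ?I s'' \<and> 1 + t + f s'' \<le> f s')"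
      using kW by (simp add: wp_simps k_def[symmetric])
  next
    show "?I s" using assms reg2[OF assms(1)] by (simp add: T_def)
  next
    fix t s'
    assume *: "?I s' \<and> \<not> holds N win s' (Less (Reg 2) (Reg 6)) \<and> t + f s' \<le> f s + 1"
    then have "reg s' 2 = T" by auto
    then show "settled P K (reg s 6) s' \<and>
       t \<le> (\<Sum>x\<in>{i<..reg s 6}. level_cost x (2 ^ K) + 6) + 1"
      using * reg2[OF assms(1)] by (auto simp: T_def f_def)
  qed
qed

end

section \<open>Starting a phase\<close>

text \<open>The surviving edges are collected in place, at the front of the entries being read.
  Clearing the position in chunk 6 marks an edge as taken, so one that is named by several entries
  is kept once. Clearing chunk 8 at both end points frees all vertices for the new phase.\<close>

definition compact_body :: com where
  "compact_body =
     Seq (Assign 7 (Add (Reg 7) (Const 1)))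
    (Seq (Assign 9 (Cell 2 (Const 0) (Reg 7)))
    (Seq (Assign 10 (Cell 3 (Const 0) (Reg 7)))
    (Seq (Store 8 (Const 0) (Reg 9) (Const 0))
    (Seq (Store 8 (Const 0) (Reg 10) (Const 0))
      (If (Equal (Cell 6 (Reg 9) (Reg 10)) (Reg 5))
        (Seq (Assign 8 (Add (Reg 8) (Const 1)))
        (Seq (Store 2 (Const 0) (Reg 8) (Reg 9))
        (Seq (Store 3 (Const 0) (Reg 8) (Reg 10))
        (Seq (Store 4 (Const 0) (Reg 8) (Const 1))
        (Seq (Store 6 (Reg 9) (Reg 10) (Const 0))
             (Store 7 (Reg 9) (Reg 10) (Reg 5)))))))
        Skip)))))"

definition compact_prog :: com where
  "compact_prog = Seq (Assign 7 (Const 0)) (Seq (Assign 8 (Const 0))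
     (While (Less (Reg 7) (Reg 3)) compact_body))"

definition append_body :: com where
  "append_body =
     Seq (Assign 8 (Add (Reg 8) (Const 1)))
    (Seq (If (Less (Op_Fst (Reg 12)) (Op_Snd (Reg 12)))
           (Seq (Assign 9 (Op_Fst (Reg 12))) (Assign 10 (Op_Snd (Reg 12))))
           (Seq (Assign 9 (Op_Snd (Reg 12))) (Assign 10 (Op_Fst (Reg 12)))))
    (Seq (Store 2 (Const 0) (Reg 8) (Reg 9))
    (Seq (Store 3 (Const 0) (Reg 8) (Reg 10))
    (Seq (Store 4 (Const 0) (Reg 8) (Op_Kind (Reg 12)))
    (Seq (Store 6 (Reg 9) (Reg 10) (Const 0))
    (Seq (Store 7 (Reg 9) (Reg 10) (Reg 5))
         (Assign 12 (Add (Reg 12) (Const 1)))))))))"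

text \<open>The target time in register 6 is one past the replayed insertions: the update that
  starts the phase also has to handle its own entry.\<close>

definition append_prog :: com where
  "append_prog = Seq (Assign 6 (Add (Reg 8) (Const 1))) (Seq (Assign 12 (Const 0))
     (While (Neg (Equal (Op_Kind (Reg 12)) (Const 0))) append_body))"

definition width_prog :: com where
  "width_prog = Seq (Assign 3 (Reg 8)) (Seq (Assign 2 (Const 0)) (Seq (Assign 4 (Const 1))
     (While (Neg (Less (Reg 3) (Mul (Const 2) (Reg 4)))) (Assign 4 (Mul (Const 2) (Reg 4))))))"

text \<open>The scan runs backwards, and chunk 7 holds for each edge its next deletion after the
  current entry. It is read before it is overwritten, as \<open>next_del\<close> counts only
  deletions strictly after the entry.\<close>

definition deletion_body :: com where
  "deletion_body =
     Seq (Assign 9 (Cell 2 (Const 0) (Reg 7)))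
    (Seq (Assign 10 (Cell 3 (Const 0) (Reg 7)))
    (Seq (Store 5 (Const 0) (Reg 7) (Cell 7 (Reg 9) (Reg 10)))
    (Seq (If (Equal (Cell 4 (Const 0) (Reg 7)) (Const 2)) (Store 7 (Reg 9) (Reg 10) (Reg 7)) Skip)
         (Assign 7 (Sub (Reg 7) (Const 1))))))"

definition deletion_prog :: com where
  "deletion_prog = Seq (Assign 7 (Reg 3)) (While (Less (Const 0) (Reg 7)) deletion_body)"

definition rebuild_prog :: com where
  "rebuild_prog = Seq compact_prog (Seq append_prog (Seq width_prog deletion_prog))"

section \<open>Normalised updates and freshly loaded entries\<close>

fun norm_op :: "op \<Rightarrow> op" where
  "norm_op (Ins u v) = Ins (min u v) (max u v)"
| "norm_op (Del u v) = Del (min u v) (max u v)"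

lemma norm_op_simps [simp]:
  "op_fst (norm_op q) = min (op_fst q) (op_snd q)"
  "op_snd (norm_op q) = max (op_fst q) (op_snd q)"
  "op_kind (norm_op q) = op_kind q"
  by (cases q; simp)+

lemma apply_norm_op [simp]: "apply_op (norm_op q) = apply_op q"
  by (rule ext, cases q) (auto simp: min_def max_def insert_commute)

lemma normal_norm_op: "valid_op n q \<Longrightarrow> normal_ops n [norm_op q]"
  by (cases q) (auto simp: normal_ops_def)

lemma normal_ops_append [simp]: "normal_ops n (P @ Q) \<longleftrightarrow> normal_ops n P \<and> normal_ops n Q"
  by (auto simp: normal_ops_def)

lemma op_at_append: "1 \<le> t \<Longrightarrow> t \<le> length P \<Longrightarrow> op_at (P @ Q) t = op_at P t"
  by (auto simp: op_at_def nth_append)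

lemma op_at_snoc: "op_at (P @ [q]) (Suc (length P)) = q"
  by (simp add: op_at_def)

text \<open>The start values: 0 says that the edge is absent at time 0, \<open>never n\<close> that
  no deletion follows the last entry. Only the positions of edges in \<open>P\<close> are mentioned,
  for all others may contain anything.\<close>

definition loaded :: "nat \<Rightarrow> op list \<Rightarrow> state \<Rightarrow> bool" where
  "loaded n P s \<longleftrightarrow> normal_ops n P \<and> (\<forall>t. 1 \<le> t \<and> t \<le> length P \<longrightarrow> stored P t s \<and>
     cell s 6 (op_fst (op_at P t)) (op_snd (op_at P t)) = 0 \<and>
     cell s 7 (op_fst (op_at P t)) (op_snd (op_at P t)) = never n)"

lemma loaded_snoc:
  assumes "loaded n P s" "normal_ops n [q]"
    and c: "\<And>t. cell s' 2 0 t = (if t = Suc (length P) then op_fst q else cell s 2 0 t)"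
      "\<And>t. cell s' 3 0 t = (if t = Suc (length P) then op_snd q else cell s 3 0 t)"
      "\<And>t. cell s' 4 0 t = (if t = Suc (length P) then op_kind q else cell s 4 0 t)"
      "\<And>a b. cell s' 6 a b = (if a = op_fst q \<and> b = op_snd q then 0 else cell s 6 a b)"
      "\<And>a b. cell s' 7 a b = (if a = op_fst q \<and> b = op_snd q then never n else cell s 7 a b)"
  shows "loaded n (P @ [q]) s'"
proof -
  have "stored (P @ [q]) t s' \<and>
     cell s' 6 (op_fst (op_at (P @ [q]) t)) (op_snd (op_at (P @ [q]) t)) = 0 \<and>
     cell s' 7 (op_fst (op_at (P @ [q]) t)) (op_snd (op_at (P @ [q]) t)) = never n"
    if t: "1 \<le> t" "t \<le> Suc (length P)" for t
  proof (cases "t = Suc (length P)")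
    case True
    then have "op_at (P @ [q]) t = q" by (simp add: op_at_snoc)
    then show ?thesis using True by (simp add: stored_def c)
  next
    case False
    then have t': "t \<le> length P" using t by simp
    then have "op_at (P @ [q]) t = op_at P t" using t by (simp add: op_at_append)
    then show ?thesis using assms(1) t(1) t' False unfolding loaded_def stored_def by (simp add: c)
  qed
  then show ?thesis using assms(1,2) unfolding loaded_def by simp
qed

section \<open>Verification of the programs that start a phase\<close>

context ram
begin

text \<open>\<open>E\<close> holds one insertion for each surviving edge met so far. It shares
  chunks 2 to 4 with the unread rest of \<open>P\<close>, and \<open>reg s 8 \<le> reg s 7\<close>
  keeps the two apart. In chunk 6 the value \<open>never n\<close> marks the survivors not yet
  taken.\<close>

definition compact_inv :: "op list \<Rightarrow> op list \<Rightarrow> state \<Rightarrow> bool" where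
  "compact_inv P E s \<longleftrightarrow> geometry n s \<and> reg s 3 = length P \<and> reg s 5 = never n \<and> reg s 7 \<le> length P \<and>
     (\<forall>t. reg s 7 < t \<and> t \<le> length P \<longrightarrow> stored P t s) \<and>
     (\<forall>u<n. cell s 8 0 u \<noteq> 0 \<longrightarrow> (\<exists>t. reg s 7 < t \<and> t \<le> length P \<and> u \<in> op_edge (op_at P t))) \<and>
     loaded n E s \<and> length E = reg s 8 \<and> reg s 8 \<le> reg s 7 \<and> (\<forall>q\<in>set E. op_kind q = 1) \<and>
     distinct (map (\<lambda>q. op_edge q) E) \<and>
     (\<lambda>q. op_edge q) ` set E = (\<lambda>t. op_edge (op_at P t)) ` {1..reg s 7} \<inter> graph_at P (length P) \<and>
     (\<forall>t. 1 \<le> t \<and> t \<le> length P \<longrightarrow>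
        (cell s 6 (op_fst (op_at P t)) (op_snd (op_at P t)) = never n \<longleftrightarrow>
         op_edge (op_at P t) \<in> graph_at P (length P) - (\<lambda>q. op_edge q) ` set E))"

lemma compact_body:
  assumes I: "compact_inv P E s" and lt: "reg s 7 < length P"
    and P: "normal_ops n P" "length P \<le> n * n"
  shows "wp N win compact_body s (\<lambda>t s'. (\<exists>E. compact_inv P E s') \<and> reg s' 7 = Suc (reg s 7) \<and> t \<le> 12)"
proof -
  let ?t = "Suc (reg s 7)"
  define u v where "u = op_fst (op_at P ?t)" and "v = op_snd (op_at P ?t)"
  have geo: "geometry n s" and regs: "reg s 3 = length P" "reg s 5 = never n"
    and st: "\<And>t. reg s 7 < t \<Longrightarrow> t \<le> length P \<Longrightarrow> stored P t s"
    and E: "loaded n E s" "length E = reg s 8" "reg s 8 \<le> reg s 7" "\<forall>q\<in>set E. op_kind q = 1"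
      "distinct (map (\<lambda>q. op_edge q) E)"
      "(\<lambda>q. op_edge q) ` set E = (\<lambda>t. op_edge (op_at P t)) ` {1..reg s 7} \<inter> graph_at P (length P)"
    and live: "\<And>t. 1 \<le> t \<Longrightarrow> t \<le> length P \<Longrightarrow>
      cell s 6 (op_fst (op_at P t)) (op_snd (op_at P t)) = never n \<longleftrightarrow>
      op_edge (op_at P t) \<in> graph_at P (length P) - (\<lambda>q. op_edge q) ` set E"
    using I unfolding compact_inv_def by simp_all
  have ex: "\<exists>t. reg s 7 < t \<and> t \<le> length P \<and> u \<in> op_edge (op_at P t)"
    if "u < n" "cell s 8 0 u \<noteq> 0" for u
    using I that unfolding compact_inv_def by (elim conjE) metis
  have uv: "u < v" "v < n" "u < n"
    using normal_ops_at[OF P(1), of ?t] lt by (auto simp: u_def v_def)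
  have cells: "cell s 2 0 ?t = u" "cell s 3 0 ?t = v"
    using st[of ?t] lt by (auto simp: stored_def u_def v_def)
  have W: "1 < word_bound N" "?t < word_bound N" "Suc (reg s 8) < word_bound N"
    using word_bound_ge lt P(2) E(3) by linarith+
  have size: "?t \<le> n * n" "Suc (reg s 8) \<le> n * n" using lt P(2) E(3) by auto
  let ?s1 = "store 8 0 v 0 (store 8 0 u 0 (s\<lparr>reg := (reg s)(7 := ?t, 9 := u, 10 := v)\<rparr>))"
  let ?s2 = "store 7 u v (never n) (store 6 u v 0 (store 4 0 (Suc (reg s 8)) 1
    (store 3 0 (Suc (reg s 8)) v (store 2 0 (Suc (reg s 8)) u
      (?s1\<lparr>reg := (reg ?s1)(8 := Suc (reg s 8))\<rparr>)))))"
  have ends: "op_edge (op_at P ?t) = {u, v}" by (simp add: u_def v_def)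
  have split: "{1..?t} = insert ?t {1..reg s 7}" by auto
  have ex1: "\<exists>t. ?t < t \<and> t \<le> length P \<and> x \<in> op_edge (op_at P t)"
    if "x < n" "cell ?s1 8 0 x \<noteq> 0" for x
  proof -
    have x: "x \<noteq> u" "x \<noteq> v" "cell s 8 0 x \<noteq> 0"
      using that uv geo by (auto simp: in_bounds_def geometry_def split: if_splits)
    from ex[OF that(1) x(3)] obtain t where t: "reg s 7 < t" "t \<le> length P" "x \<in> op_edge (op_at P t)" by blast
    then have "t \<noteq> ?t" using x ends by blast
    then show ?thesis using t by (intro exI[of _ t]) auto
  qed
  show ?thesis
  proof (cases "cell s 6 u v = never n")
    case False
    then have "{u, v} \<notin> graph_at P (length P) - (\<lambda>q. op_edge q) ` set E"
      using live[of ?t] lt by (simp add: u_def v_def)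
    then have "(\<lambda>t. op_edge (op_at P t)) ` {1..?t} \<inter> graph_at P (length P) = (\<lambda>q. op_edge q) ` set E"
      unfolding split image_insert ends using E(6) by blast
    then have "compact_inv P E ?s1"
      unfolding compact_inv_def
      apply (intro conjI)
      subgoal using geo by (simp add: geometry_def)
      subgoal using regs by simp
      subgoal using regs by simp
      subgoal using lt by simp
      subgoal using st by (simp add: stored_def)
      subgoal using ex1 by simp
      subgoal using E(1) by (simp add: loaded_def stored_def)
      subgoal using E(2) by simp
      subgoal using E(3) by simp
      subgoal using E(4) .
      subgoal using E(5) .
      subgoal using E(6) by simp
      subgoal using live by simp
      done
    then have "\<exists>E. compact_inv P E ?s1" by (rule exI[of "\<lambda>E. compact_inv P E ?s1" E])
    then show ?thesis
      using False geo regs uv cells W size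
      by (simp add: compact_body_def wp_simps Let_def in_bounds_def geometry_def)
  next
    case True
    then have new: "{u, v} \<in> graph_at P (length P)" "{u, v} \<notin> (\<lambda>q. op_edge q) ` set E"
      using live[of ?t] lt by (simp_all add: u_def v_def)
    have load: "loaded n (E @ [Ins u v]) ?s2"
      by (rule loaded_snoc[OF E(1)])
        (use E(2) uv geo size in \<open>auto simp: normal_ops_def in_bounds_def geometry_def\<close>)
    have "(\<lambda>t. op_edge (op_at P t)) ` {1..?t} \<inter> graph_at P (length P) =
      insert {u, v} ((\<lambda>q. op_edge q) ` set E)"
      unfolding split image_insert ends using E(6) new by blast
    moreover have "stored P t ?s2" if "?t < t" "t \<le> length P" for t
      using st[of t] that E(3) by (simp add: stored_def)
    moreover have "cell ?s2 6 (op_fst (op_at P t)) (op_snd (op_at P t)) = never n \<longleftrightarrow>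
      op_edge (op_at P t) \<in> graph_at P (length P) - (\<lambda>q. op_edge q) ` set (E @ [Ins u v])"
      if t: "1 \<le> t" "t \<le> length P" for t
    proof -
      have "op_edge (op_at P t) = {u, v} \<longleftrightarrow> op_fst (op_at P t) = u \<and> op_snd (op_at P t) = v"
        using normal_ops_at[OF P(1) t] uv by (auto simp: doubleton_eq_iff)
      then show ?thesis using live[OF t] uv geo by (auto simp: in_bounds_def geometry_def never_def)
    qed
    ultimately have "compact_inv P (E @ [Ins u v]) ?s2"
      unfolding compact_inv_def
      apply (intro conjI)
      subgoal using geo by (simp add: geometry_def)
      subgoal using regs by simp
      subgoal using regs by simp
      subgoal using lt by simp
      subgoal by simp
      subgoal using ex1 by simp
      subgoal by (rule load)
      subgoal using E(2) by simp
      subgoal using E(3) by simp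
      subgoal using E(4) by auto
      subgoal using E(5) new(2) by auto
      subgoal by simp
      subgoal by simp
      done
    then have "\<exists>E. compact_inv P E ?s2" by (rule exI[of "\<lambda>E. compact_inv P E ?s2" "E @ [Ins u v]"])
    then show ?thesis
      using True geo regs uv cells W size
      by (simp add: compact_body_def wp_simps Let_def in_bounds_def geometry_def)
  qed
qed

end

lemma graph_at_edges:
  assumes "e \<in> graph_at P t"
  shows "\<exists>t'. 1 \<le> t' \<and> t' \<le> length P \<and> e = op_edge (op_at P t')"
  using change_between[of e P t 0 0 "Suc t"] assms by (auto simp: Suc_le_eq)

context ram
begin

lemma compact_prog:
  assumes "settled P K (length P) s"
  shows "wp N win compact_prog s (\<lambda>t s'. (\<exists>E. compact_inv P E s') \<and> reg s' 7 = length P \<and>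
     t \<le> 13 * length P + 3)"
proof -
  let ?s = "s\<lparr>reg := (reg s)(7 := 0, 8 := 0)\<rparr>"
  have phase: "phase_inv n K P s" and time: "time_inv n P (length P) s"
    and level: "level_inv P n K (length P) 0 (cell s 8 0) (cell s 9 0)"
    using assms unfolding settled_def by auto
  have P: "normal_ops n P" "length P \<le> n * n" using phase unfolding phase_inv_def by auto
  have "length P < never n" using P(2) by (simp add: never_def)
  then have live: "cell s 6 (op_fst (op_at P t)) (op_snd (op_at P t)) = never n \<longleftrightarrow>
      op_edge (op_at P t) \<in> graph_at P (length P)" if "1 \<le> t" "t \<le> length P" for t
    using lives_until_end time that unfolding time_inv_def by blast
  have "compact_inv P [] ?s"
    unfolding compact_inv_def
    apply (intro conjI)
    subgoal using phase by (simp add: phase_inv_def geometry_def)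
    subgoal using phase by (simp add: phase_inv_def)
    subgoal using phase by (simp add: phase_inv_def)
    subgoal by simp
    subgoal using phase by (simp add: phase_inv_def stored_def)
    \<comment> \<open>The last clause of \<open>level_inv\<close> was carried along for this: a
      nonzero expiry occurs only at end points of entries, so scanning the entries resets all of
      chunk 8.\<close>
    subgoal using level unfolding level_inv_def by (simp add: Suc_le_eq)
    subgoal by (simp add: loaded_def normal_ops_def)
    subgoal by simp
    subgoal by simp
    subgoal by simp
    subgoal by simp
    subgoal by simp
    subgoal using live by simp
    done
  then have start: "\<exists>E. compact_inv P E ?s" by (rule exI[of "\<lambda>E. compact_inv P E ?s" "[]"])
  have "wp N win (While (Less (Reg 7) (Reg 3)) compact_body) ?s
    (\<lambda>t s'. (\<exists>E. compact_inv P E s') \<and> reg s' 7 = length P \<and> t \<le> 13 * length P + 1)"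
  proof (rule wp_conseq[OF wp_While[where I = "\<lambda>s. \<exists>E. compact_inv P E s" and
        f = "\<lambda>s. 13 * (length P - reg s 7)"]])
    show "\<exists>E. compact_inv P E ?s" by (rule start)
  next
    fix s assume "\<exists>E. compact_inv P E s" and b: "holds N win s (Less (Reg 7) (Reg 3))"
    then obtain E where E: "compact_inv P E s" by blast
    have lt: "reg s 7 < length P" using E b unfolding compact_inv_def by simp
    have "13 * (length P - reg s 7) = 13 + 13 * (length P - Suc (reg s 7))" using lt by simp
    then show "wp N win compact_body s (\<lambda>t s'. (\<exists>E. compact_inv P E s') \<and>
       1 + t + 13 * (length P - reg s' 7) \<le> 13 * (length P - reg s 7))"
      by (intro wp_conseq[OF compact_body[OF E lt P]]) auto
  next
    fix t s' assume *: "(\<exists>E. compact_inv P E s') \<and> \<not> holds N win s' (Less (Reg 7) (Reg 3)) \<and>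
      t + 13 * (length P - reg s' 7) \<le> 13 * (length P - reg ?s 7) + 1"
    then have "reg s' 3 = length P" "reg s' 7 \<le> length P" unfolding compact_inv_def by auto
    then show "(\<exists>E. compact_inv P E s') \<and> reg s' 7 = length P \<and> t \<le> 13 * length P + 1"
      using * by auto
  qed
  then have "wp N win (While (Less (Reg 7) (Reg 3)) compact_body) ?s
    (\<lambda>t s'. (\<exists>E. compact_inv P E s') \<and> reg s' 7 = length P \<and> 1 + (1 + t) \<le> 13 * length P + 3)"
    by (rule wp_conseq) auto
  then show ?thesis by (simp add: compact_prog_def wp_simps del: One_nat_def)
qed

definition append_inv :: "op list \<Rightarrow> op list \<Rightarrow> state \<Rightarrow> bool" where
  "append_inv E win s \<longleftrightarrow> geometry n s \<and> reg s 5 = never n \<and> reg s 12 \<le> length win \<and>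
     reg s 8 = length E + reg s 12 \<and> loaded n (E @ map norm_op (take (reg s 12) win)) s"

lemma append_body:
  assumes I: "append_inv E win s" and lt: "reg s 12 < length win"
    and win: "\<forall>q\<in>set win. valid_op n q" "length E + length win \<le> n * n"
  shows "wp N win append_body s (\<lambda>t s'. append_inv E win s' \<and> reg s' 12 = Suc (reg s 12) \<and> t = 10)"
proof -
  let ?d = "reg s 12"
  let ?q = "norm_op (win ! ?d)"
  let ?P = "E @ map norm_op (take ?d win)"
  define u v where "u = op_fst ?q" and "v = op_snd ?q"
  have I: "geometry n s" "reg s 5 = never n" "reg s 8 = length E + ?d" "loaded n ?P s"
    using I unfolding append_inv_def by auto
  have q: "normal_ops n [?q]" using win(1) lt by (intro normal_norm_op) simp
  then have uv: "u < v" "v < n" "u < n" by (auto simp: normal_ops_def u_def v_def)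
  have W: "1 < word_bound N" "Suc (reg s 8) < word_bound N" "Suc ?d < word_bound N" and
    size: "Suc (reg s 8) \<le> n * n"
    using word_bound_ge lt win(2) I(3) by linarith+
  let ?s = "store 7 u v (never n) (store 6 u v 0 (store 4 0 (Suc (reg s 8)) (op_kind ?q)
    (store 3 0 (Suc (reg s 8)) v (store 2 0 (Suc (reg s 8)) u
      (s\<lparr>reg := (reg s)(8 := Suc (reg s 8), 9 := u, 10 := v)\<rparr>)))))"
  let ?s' = "?s\<lparr>reg := (reg ?s)(12 := Suc ?d)\<rparr>"
  have len: "length ?P = reg s 8" using lt I(3) by simp
  have "loaded n (?P @ [?q]) ?s'"
    by (rule loaded_snoc[OF I(4) q, unfolded len])
      (use uv I(1) size in \<open>auto simp: in_bounds_def geometry_def u_def v_def\<close>)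
  moreover have "?P @ [?q] = E @ map norm_op (take (Suc ?d) win)"
    using lt by (simp add: take_Suc_conv_app_nth)
  ultimately have inv: "append_inv E win ?s'"
    using I lt unfolding append_inv_def by (simp add: geometry_def)
  have uv': "(if op_fst (win ! ?d) < op_snd (win ! ?d) then op_fst (win ! ?d) else op_snd (win ! ?d)) = u"
    "(if op_fst (win ! ?d) < op_snd (win ! ?d) then op_snd (win ! ?d) else op_fst (win ! ?d)) = v"
    by (auto simp: u_def v_def)
  show ?thesis
  proof (cases "op_fst (win ! ?d) < op_snd (win ! ?d)")
    case True
    then have "op_fst (win ! ?d) = u" "op_snd (win ! ?d) = v" using uv' by simp_all
    then show ?thesis using inv I(2) lt W uv by (simp add: append_body_def wp_simps inspect_def)
  next
    case False
    then have "op_fst (win ! ?d) = v" "op_snd (win ! ?d) = u" using uv' by simp_all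
    then show ?thesis using inv I(2) lt W uv by (simp add: append_body_def wp_simps inspect_def)
  qed
qed

lemma append_prog:
  assumes E: "loaded n E s" "length E = reg s 8" "geometry n s" "reg s 5 = never n"
    and win: "\<forall>q\<in>set win. valid_op n q" "length E + length win \<le> n * n"
  shows "wp N win append_prog s (\<lambda>t s'. loaded n (E @ map norm_op win) s' \<and>
     reg s' 8 = length E + length win \<and> reg s' 6 = length E + 1 \<and> geometry n s' \<and>
     reg s' 5 = never n \<and> t \<le> 11 * length win + 3)"
proof -
  let ?s = "s\<lparr>reg := (reg s)(6 := reg s 8 + 1, 12 := 0)\<rparr>"
  have W: "1 < word_bound N" "reg s 8 + 1 < word_bound N" using word_bound_ge E(2) win(2) by linarith+
  have start: "append_inv E win ?s"
    using E unfolding append_inv_def by (simp add: geometry_def loaded_def stored_def)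
  have "wp N win (While (Neg (Equal (Op_Kind (Reg 12)) (Const 0))) append_body) ?s
     (\<lambda>t s'. loaded n (E @ map norm_op win) s' \<and>
     reg s' 8 = length E + length win \<and> reg s' 6 = length E + 1 \<and> geometry n s' \<and>
     reg s' 5 = never n \<and> 1 + (1 + t) \<le> 11 * length win + 3)"
  proof (rule wp_conseq[OF wp_While[where I = "append_inv E win" and f = "\<lambda>s. 11 * (length win - reg s 12)"]])
    show "append_inv E win ?s" by (rule start)
  next
    fix s assume I: "append_inv E win s" and "holds N win s (Neg (Equal (Op_Kind (Reg 12)) (Const 0)))"
    then have lt: "reg s 12 < length win" by (simp add: inspect_def split: if_splits)
    have "11 * (length win - reg s 12) = 11 + 11 * (length win - Suc (reg s 12))" using lt by simp
    then show "wp N win append_body s (\<lambda>t s'. append_inv E win s' \<and>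
       1 + t + 11 * (length win - reg s' 12) \<le> 11 * (length win - reg s 12))"
      by (intro wp_conseq[OF append_body[OF I lt win]]) auto
  next
    fix t s'
    assume e: "exec N win (While (Neg (Equal (Op_Kind (Reg 12)) (Const 0))) append_body) ?s t s'"
      and *: "append_inv E win s' \<and> \<not> holds N win s' (Neg (Equal (Op_Kind (Reg 12)) (Const 0))) \<and>
      t + 11 * (length win - reg s' 12) \<le> 11 * (length win - reg ?s 12) + 1"
    have "op_kind (win ! reg s' 12) \<noteq> 0" using op_kind_cases[of "win ! reg s' 12"] by auto
    then have "reg s' 12 = length win" using * by (auto simp: inspect_def append_inv_def split: if_splits)
    moreover have "reg s' 6 = length E + 1"
      using exec_reg[OF e, of 6] E(2) by (simp add: append_body_def)
    ultimately show "loaded n (E @ map norm_op win) s' \<and>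
     reg s' 8 = length E + length win \<and> reg s' 6 = length E + 1 \<and> geometry n s' \<and>
     reg s' 5 = never n \<and> 1 + (1 + t) \<le> 11 * length win + 3"
      using * by (auto simp: append_inv_def)
  qed
  then show ?thesis using W by (simp add: append_prog_def wp_simps del: One_nat_def)
qed

lemma width_prog:
  assumes "reg s 8 \<le> n * n"
  shows "wp N win width_prog s (\<lambda>t s'. reg s' 3 = reg s 8 \<and> reg s' 2 = 0 \<and>
     (\<exists>K. reg s' 4 = 2 ^ K \<and> 2 ^ K \<le> reg s 8 + 1 \<and> reg s 8 < 2 * 2 ^ K) \<and> t \<le> 2 * reg s 8 + 4)"
proof -
  let ?y = "reg s 8"
  let ?s = "s\<lparr>reg := (reg s)(3 := ?y, 2 := 0, 4 := 1)\<rparr>"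
  let ?I = "\<lambda>s. reg s 3 = ?y \<and> reg s 2 = 0 \<and> (\<exists>K. reg s 4 = 2 ^ K \<and> 2 ^ K \<le> ?y + 1)"
  let ?Q = "\<lambda>t s'. reg s' 3 = ?y \<and> reg s' 2 = 0 \<and>
     (\<exists>K. reg s' 4 = 2 ^ K \<and> 2 ^ K \<le> ?y + 1 \<and> ?y < 2 * 2 ^ K) \<and> t \<le> 2 * ?y + 4"
  have W: "2 < word_bound N" using word_bound_ge by linarith
  have "wp N win (While (Neg (Less (Reg 3) (Mul (Const 2) (Reg 4)))) (Assign 4 (Mul (Const 2) (Reg 4)))) ?s
     (\<lambda>t. ?Q (1 + (1 + (1 + t))))"
  \<comment> \<open>A linear time bound is enough within a rebuilding of linear cost, so the measure
    uses only that doubling adds at least 1.\<close>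
  proof (rule wp_conseq[OF wp_While[where I = ?I and f = "\<lambda>s. 2 * (?y + 1 - reg s 4)"]])
    show "?I ?s" by (auto intro!: exI[of _ 0])
  next
    fix s assume I: "?I s" and b: "holds N win s (Neg (Less (Reg 3) (Mul (Const 2) (Reg 4))))"
    from I obtain K where K: "reg s 4 = 2 ^ K" "2 ^ K \<le> ?y + 1" by blast
    have W': "2 * 2 ^ K < word_bound N" using K(2) word_bound_ge assms by linarith
    have le: "2 * 2 ^ K \<le> ?y" using b I K W W' by simp
    have "(1::nat) \<le> 2 ^ K" by simp
    then have "2 + 2 * (?y + 1 - 2 * 2 ^ K) \<le> 2 * (?y + 1 - 2 ^ K)" using le by linarith
    moreover have "\<exists>L. 2 * 2 ^ K = (2::nat) ^ L \<and> 2 ^ L \<le> ?y + 1" using le by (intro exI[of _ "Suc K"]) simp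
    ultimately show "wp N win (Assign 4 (Mul (Const 2) (Reg 4))) s
      (\<lambda>t s'. ?I s' \<and> 1 + t + 2 * (?y + 1 - reg s' 4) \<le> 2 * (?y + 1 - reg s 4))"
      using I K W W' by (simp add: wp_simps)
  next
    fix t s'
    assume *: "?I s' \<and> \<not> holds N win s' (Neg (Less (Reg 3) (Mul (Const 2) (Reg 4)))) \<and>
      t + 2 * (?y + 1 - reg s' 4) \<le> 2 * (?y + 1 - reg ?s 4) + 1"
    then obtain K where K: "reg s' 4 = 2 ^ K" "2 ^ K \<le> ?y + 1" by blast
    have "2 * 2 ^ K < word_bound N" using K(2) word_bound_ge assms by linarith
    then show "?Q (1 + (1 + (1 + t))) s'" using * K W by (auto intro!: exI[of _ K])
  qed
  then show ?thesis using W by (simp add: width_prog_def wp_simps del: One_nat_def)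
qed

definition deletion_inv :: "op list \<Rightarrow> state \<Rightarrow> bool" where
  "deletion_inv P s \<longleftrightarrow> geometry n s \<and> reg s 7 \<le> length P \<and>
     (\<forall>t. 1 \<le> t \<and> t \<le> length P \<longrightarrow> stored P t s \<and>
        next_del P (never n) (op_edge (op_at P t)) (reg s 7)
          (cell s 7 (op_fst (op_at P t)) (op_snd (op_at P t)))) \<and>
     (\<forall>t. reg s 7 < t \<and> t \<le> length P \<longrightarrow>
        next_del P (never n) (op_edge (op_at P t)) t (cell s 5 0 t))"

lemma deletion_body:
  assumes I: "deletion_inv P s" and pos: "0 < reg s 7"
    and P: "normal_ops n P" "length P \<le> n * n"
  shows "wp N win deletion_body s (\<lambda>t s'. deletion_inv P s' \<and> reg s' 7 = reg s 7 - 1 \<and> t \<le> 6)"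
proof -
  obtain x where x: "reg s 7 = Suc x" using pos gr0_conv_Suc by blast
  define u v where "u = op_fst (op_at P (Suc x))" and "v = op_snd (op_at P (Suc x))"
  have len: "Suc x \<le> length P" and geo: "geometry n s"
    and st: "\<And>t. 1 \<le> t \<Longrightarrow> t \<le> length P \<Longrightarrow> stored P t s"
    and nd: "\<And>t. 1 \<le> t \<Longrightarrow> t \<le> length P \<Longrightarrow> next_del P (never n) (op_edge (op_at P t)) (Suc x)
          (cell s 7 (op_fst (op_at P t)) (op_snd (op_at P t)))"
    and old: "\<And>t. Suc x < t \<Longrightarrow> t \<le> length P \<Longrightarrow>
        next_del P (never n) (op_edge (op_at P t)) t (cell s 5 0 t)"
    using I x unfolding deletion_inv_def by simp_all
  have uv: "u < v" "v < n" "u < n"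
    using normal_ops_at[OF P(1), of "Suc x"] len by (auto simp: u_def v_def)
  have cells: "cell s 2 0 (Suc x) = u" "cell s 3 0 (Suc x) = v" "cell s 4 0 (Suc x) = op_kind (op_at P (Suc x))"
    using st[of "Suc x"] len by (auto simp: stored_def u_def v_def)
  have W: "2 < word_bound N" using word_bound_ge by linarith
  have size: "Suc x \<le> n * n" "Suc x < never n" using len P(2) by (auto simp: never_def)
  let ?s1 = "store 5 0 (Suc x) (cell s 7 u v) (s\<lparr>reg := (reg s)(9 := u, 10 := v)\<rparr>)"
  let ?s2 = "if op_kind (op_at P (Suc x)) = 2 then store 7 u v (Suc x) ?s1 else ?s1"
  let ?s3 = "?s2\<lparr>reg := (reg ?s2)(7 := x)\<rparr>"
  have "next_del P (never n) (op_edge (op_at P t)) x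
      (cell ?s3 7 (op_fst (op_at P t)) (op_snd (op_at P t)))" if t: "1 \<le> t" "t \<le> length P" for t
  proof -
    have "op_edge (op_at P t) = {u, v} \<longleftrightarrow> op_fst (op_at P t) = u \<and> op_snd (op_at P t) = v"
      using normal_ops_at[OF P(1) t] uv by (auto simp: doubleton_eq_iff)
    then have "cell ?s3 7 (op_fst (op_at P t)) (op_snd (op_at P t)) =
      (if deletes P (Suc x) (op_edge (op_at P t)) then Suc x
       else cell s 7 (op_fst (op_at P t)) (op_snd (op_at P t)))"
      using len uv geo by (auto simp: deletes_def in_bounds_def geometry_def u_def[symmetric] v_def[symmetric])
    then show ?thesis using next_del_pred[OF nd[OF t] size(2)] by simp
  qed
  moreover have "next_del P (never n) (op_edge (op_at P t)) t (cell ?s3 5 0 t)"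
    if "x < t" "t \<le> length P" for t
  proof (cases "t = Suc x")
    case True
    then show ?thesis using nd[of t] len geo size(1)
      by (simp add: in_bounds_def geometry_def u_def v_def)
  next
    case False
    then show ?thesis using old[of t] that by simp
  qed
  ultimately have inv: "deletion_inv P ?s3"
    using geo st len unfolding deletion_inv_def by (simp add: geometry_def stored_def)
  show ?thesis
  proof (cases "op_kind (op_at P (Suc x)) = 2")
    case True
    then show ?thesis using inv x cells geo size(1) uv W
      by (simp add: deletion_body_def wp_simps Let_def in_bounds_def geometry_def)
  next
    case False
    then show ?thesis using inv x cells geo size(1) uv W
      by (simp add: deletion_body_def wp_simps Let_def in_bounds_def geometry_def)
  qed
qed

lemma deletion_prog:
  assumes P: "loaded n P s" "length P \<le> n * n" and s: "geometry n s" "reg s 3 = length P"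
  shows "wp N win deletion_prog s (\<lambda>t s'. deletion_inv P s' \<and> reg s' 7 = 0 \<and> t \<le> 7 * length P + 2)"
proof -
  let ?s = "s\<lparr>reg := (reg s)(7 := length P)\<rparr>"
  have norm: "normal_ops n P" using P(1) by (simp add: loaded_def)
  have "deletion_inv P ?s"
    using P(1) s next_del_end[of P "length P"] unfolding deletion_inv_def
    by (auto simp: geometry_def loaded_def stored_def)
  then have "wp N win (While (Less (Const 0) (Reg 7)) deletion_body) ?s
     (\<lambda>t s'. deletion_inv P s' \<and> reg s' 7 = 0 \<and> 1 + t \<le> 7 * length P + 2)"
  proof (rule wp_conseq[OF wp_While[where I = "deletion_inv P" and f = "\<lambda>s. 7 * reg s 7"]])
    fix s assume I: "deletion_inv P s" and "holds N win s (Less (Const 0) (Reg 7))"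
    then have pos: "0 < reg s 7" by auto
    show "wp N win deletion_body s (\<lambda>t s'. deletion_inv P s' \<and> 1 + t + 7 * reg s' 7 \<le> 7 * reg s 7)"
      by (rule wp_conseq[OF deletion_body[OF I pos norm P(2)]]) (use pos in auto)
  next
    fix t s'
    assume "deletion_inv P s' \<and> \<not> holds N win s' (Less (Const 0) (Reg 7)) \<and>
      t + 7 * reg s' 7 \<le> 7 * reg ?s 7 + 1"
    then show "deletion_inv P s' \<and> reg s' 7 = 0 \<and> 1 + t \<le> 7 * length P + 2"
      using word_bound_ge by auto
  qed
  then show ?thesis using s by (simp add: deletion_prog_def wp_simps del: One_nat_def)
qed

text \<open>The old entries are scanned at 13 steps each. Per new entry the cost is 11 for
  appending, 2 for finding the width and 7 for the backward scan, hence 20; the constants 3, 3, 4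
  and 2 add up to 12.\<close>

lemma rebuild_prog:
  assumes s: "settled P K (length P) s"
    and win: "\<forall>q\<in>set win. valid_op n q" "card (graph_at P (length P)) + length win \<le> n * n"
  shows "wp N win rebuild_prog s (\<lambda>t s'. \<exists>E K'. settled (E @ map norm_op win) K' 0 s' \<and>
     (\<forall>q\<in>set E. op_kind q = 1) \<and> (\<lambda>q. op_edge q) ` set E = graph_at P (length P) \<and>
     length E = card (graph_at P (length P)) \<and> reg s' 6 = length E + 1 \<and>
     t \<le> 13 * length P + 20 * (length E + length win) + 12)"
  unfolding rebuild_prog_def wp_Seq
proof (rule wp_conseq[OF compact_prog[OF s]], elim conjE exE)
  fix t1 s1 E
  assume t1: "t1 \<le> 13 * length P + 3" and E: "compact_inv P E s1" "reg s1 7 = length P"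
  have load: "loaded n E s1" "length E = reg s1 8" "geometry n s1" "reg s1 5 = never n"
    and ins: "\<forall>q\<in>set E. op_kind q = 1" and dist: "distinct (map (\<lambda>q. op_edge q) E)"
    and img: "(\<lambda>q. op_edge q) ` set E = (\<lambda>t. op_edge (op_at P t)) ` {1..length P} \<inter> graph_at P (length P)"
    using E unfolding compact_inv_def by simp_all
  have free: "cell s1 8 0 u = 0" if "u < n" for u
    using E that unfolding compact_inv_def by (metis leD)
  have set_E: "(\<lambda>q. op_edge q) ` set E = graph_at P (length P)"
    unfolding img using graph_at_edges by fastforce
  have len_E: "length E = card (graph_at P (length P))"
    using distinct_card[OF dist] set_E by simp
  with win(2) have size: "length E + length win \<le> n * n" by simp
  let ?P = "E @ map norm_op win"
  show "wp N win append_prog s1 (\<lambda>t2 s2. wp N win width_prog s2 (\<lambda>t3 s3. wp N win deletion_prog s3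
     (\<lambda>t4 s'. \<exists>E K'. settled (E @ map norm_op win) K' 0 s' \<and>
     (\<forall>q\<in>set E. op_kind q = 1) \<and> (\<lambda>q. op_edge q) ` set E = graph_at P (length P) \<and>
     length E = card (graph_at P (length P)) \<and> reg s' 6 = length E + 1 \<and>
     t1 + (t2 + (t3 + t4)) \<le> 13 * length P + 20 * (length E + length win) + 12)))"
  proof (rule wp_conseq[OF append_prog[OF load win(1) size]], elim conjE)
    fix t2 s2
    assume e2: "exec N win append_prog s1 t2 s2" and t2: "t2 \<le> 11 * length win + 3"
      and l2: "loaded n ?P s2" and r2: "reg s2 8 = length E + length win" "reg s2 6 = length E + 1"
        "geometry n s2" "reg s2 5 = never n"
    have size2: "reg s2 8 \<le> n * n" using r2(1) size by simp
    show "wp N win width_prog s2 (\<lambda>t3 s3. wp N win deletion_prog s3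
     (\<lambda>t4 s'. \<exists>E K'. settled (E @ map norm_op win) K' 0 s' \<and>
     (\<forall>q\<in>set E. op_kind q = 1) \<and> (\<lambda>q. op_edge q) ` set E = graph_at P (length P) \<and>
     length E = card (graph_at P (length P)) \<and> reg s' 6 = length E + 1 \<and>
     t1 + (t2 + (t3 + t4)) \<le> 13 * length P + 20 * (length E + length win) + 12))"
    proof (rule wp_conseq[OF width_prog[OF size2]], elim conjE exE)
      fix t3 s3 K'
      assume e3: "exec N win width_prog s2 t3 s3" and t3: "t3 \<le> 2 * reg s2 8 + 4"
        and r3: "reg s3 3 = reg s2 8" "reg s3 2 = 0" "reg s3 4 = 2 ^ K'" "2 ^ K' \<le> reg s2 8 + 1"
          "reg s2 8 < 2 * 2 ^ K'"
      note defs3 = width_prog_def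
      have c3: "cell s3 = cell s2" by (rule ext) (rule exec_cell[OF e3], simp add: defs3)
      have g3: "geometry n s3"
        using r2(3) exec_rows[OF e3] exec_cols[OF e3] by (simp add: defs3 geometry_def)
      have l3: "loaded n ?P s3" using l2 by (simp add: loaded_def stored_def c3)
      have len3: "length ?P \<le> n * n" "reg s3 3 = length ?P" using r3(1) r2(1) size by auto
      show "wp N win deletion_prog s3
         (\<lambda>t4 s'. \<exists>E K'. settled (E @ map norm_op win) K' 0 s' \<and>
         (\<forall>q\<in>set E. op_kind q = 1) \<and> (\<lambda>q. op_edge q) ` set E = graph_at P (length P) \<and>
         length E = card (graph_at P (length P)) \<and> reg s' 6 = length E + 1 \<and>
         t1 + (t2 + (t3 + t4)) \<le> 13 * length P + 20 * (length E + length win) + 12)"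
      proof (rule wp_conseq[OF deletion_prog[OF l3 len3(1) g3 len3(2)]], elim conjE)
        fix t4 s4
        assume e4: "exec N win deletion_prog s3 t4 s4" and d4: "deletion_inv ?P s4" "reg s4 7 = 0"
          and t4: "t4 \<le> 7 * length ?P + 2"
        note defs4 = deletion_prog_def deletion_body_def
        have r4: "reg s4 r = reg s3 r" if "r \<in> {2, 3, 4, 5, 6}" for r
          by (rule exec_reg[OF e4]) (use that in \<open>auto simp: defs4\<close>)
        have r3': "reg s3 5 = never n" "reg s3 6 = length E + 1"
          using exec_reg[OF e3] r2 by (auto simp: defs3)
        have c4: "cell s4 6 = cell s2 6" "cell s4 8 = cell s2 8"
          using exec_cell[OF e4] c3 by (simp_all add: defs4)
        have c2: "cell s2 8 = cell s1 8"
          by (rule exec_cell[OF e2]) (simp add: append_prog_def append_body_def)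
        have "phase_inv n K' ?P s4"
          using d4 l3 len3 r3 r3' r2(1) r4 unfolding phase_inv_def deletion_inv_def loaded_def by auto
        moreover have "time_inv n ?P 0 s4"
          using l2 r3(2) r4 lives_until_0 unfolding time_inv_def loaded_def by (simp add: c4)
        moreover have "level_inv ?P n K' 0 0 (cell s4 8 0) (cell s4 9 0)"
          by (rule level_inv_start) (simp add: c4 c2 free)
        ultimately have "settled ?P K' 0 s4" by (simp add: settled_def)
        moreover have "t1 + (t2 + (t3 + t4)) \<le> 13 * length P + 20 * (length E + length win) + 12"
          using t1 t2 t3 t4 r2(1) by simp
        ultimately show "\<exists>E K'. settled (E @ map norm_op win) K' 0 s4 \<and>
         (\<forall>q\<in>set E. op_kind q = 1) \<and> (\<lambda>q. op_edge q) ` set E = graph_at P (length P) \<and>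
         length E = card (graph_at P (length P)) \<and> reg s4 6 = length E + 1 \<and>
         t1 + (t2 + (t3 + t4)) \<le> 13 * length P + 20 * (length E + length win) + 12"
          using ins set_E len_E r4[of 6] r3' by (intro exI[of _ E] exI[of _ K']) auto
      qed
    qed
  qed
qed

end

section \<open>The algorithm and its amortized cost\<close>

text \<open>Only chunk 8 is initialised, in time linear in \<open>n\<close>; the other chunks are
  written before their contents matter. The registers describe the empty phase, whose widest block
  has width 1.\<close>

definition setup_com :: com where
  "setup_com =
     Seq (Assign 5 (Add (Mul (Const 2) (Mul (Reg 0) (Reg 0))) (Const 2)))
    (Seq (Assign 12 (Add (Mul (Reg 0) (Reg 0)) (Const 1)))
    (Seq (Alloc 2 (Const 1) (Reg 12))
    (Seq (Alloc 3 (Const 1) (Reg 12))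
    (Seq (Alloc 4 (Const 1) (Reg 12))
    (Seq (Alloc 5 (Const 1) (Reg 12))
    (Seq (Alloc 6 (Reg 0) (Reg 0))
    (Seq (Alloc 7 (Reg 0) (Reg 0))
    (Seq (Alloc 8 (Const 1) (Reg 0))
    (Seq (Alloc 9 (Const 1) (Reg 0))
    (Seq (Assign 4 (Const 1))
    (Seq (While (Less (Reg 7) (Reg 0))
           (Seq (Store 8 (Const 0) (Reg 7) (Const 0)) (Assign 7 (Add (Reg 7) (Const 1)))))
         (Assign 0 (Const 0)))))))))))))"

text \<open>The window includes the update being handled, so it is empty only if
  \<open>m = 0\<close>; then the graph never has an edge and there is nothing to do. Equality of
  registers 2 and 3 says that the phase is used up.\<close>

definition update_com :: com where
  "update_com =
     Seq (Assign 0 (Const 0))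
       (If (Equal (Op_Kind (Const 0)) (Const 0)) Skip
         (Seq (If (Equal (Reg 2) (Reg 3)) rebuild_prog (Assign 6 (Add (Reg 2) (Const 1))))
           advance_prog))"

definition query_com :: com where
  "query_com =
     If (Less (Reg 2) (Cell 8 (Const 0) (Reg 0))) (Assign 0 (Cell 9 (Const 0) (Reg 0))) (Assign 0 (Const 0))"

text \<open>Each of the \<open>L div w\<close> multiples of \<open>w\<close> up to \<open>L\<close>
  contributes \<open>w\<close>. In this form the identity holds for \<open>w = 0\<close> as
  well.\<close>

lemma sum_multiples: "(\<Sum>x\<in>{0<..L}. if w dvd x then w else 0) + L mod w = (L::nat)"
proof (induction L)
  case (Suc L)
  have "{0<..Suc L} = insert (Suc L) {0<..L}" by auto
  then have "(\<Sum>x\<in>{0<..Suc L}. if w dvd x then w else 0) =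
    (if w dvd Suc L then w else 0) + (\<Sum>x\<in>{0<..L}. if w dvd x then w else 0)" by simp
  then show ?case using Suc by (cases "w dvd Suc L") (auto simp: mod_Suc dvd_eq_mod_eq_0 split: if_splits)
qed simp

text \<open>On each of the \<open>K + 1\<close> levels, blocks of width \<open>w\<close> start only
  at multiples of \<open>w\<close>, so their costs sum to at most \<open>18 * L\<close>; the
  overhead adds \<open>6 * L\<close>.\<close>

lemma sum_level_cost: "(\<Sum>x\<in>{0<..L}. level_cost x (2 ^ K)) \<le> 24 * L * (K + 1)"
proof -
  have level: "(\<Sum>x\<in>{0<..L}. if w dvd x then 18 * w else 0) \<le> 18 * L" for w :: nat
  proof -
    have "(\<Sum>x\<in>{0<..L}. if w dvd x then 18 * w else 0) = 18 * (\<Sum>x\<in>{0<..L}. if w dvd x then w else 0)"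
      unfolding sum_distrib_left by (rule sum.cong) auto
    then show ?thesis using sum_multiples[where w = w and L = L] by linarith
  qed
  show ?thesis
  proof (induction K)
    case 0
    have "level_cost x (2 ^ 0) = 24" for x by (simp add: level_cost.simps)
    then show ?case by simp
  next
    case (Suc K)
    have "level_cost x (2 ^ Suc K) = 6 + (if 2 ^ Suc K dvd x then 18 * 2 ^ Suc K else 0) + level_cost x (2 ^ K)" for x
      by (subst level_cost.simps) simp
    then have "(\<Sum>x\<in>{0<..L}. level_cost x (2 ^ Suc K)) =
      6 * L + (\<Sum>x\<in>{0<..L}. if 2 ^ Suc K dvd x then 18 * 2 ^ Suc K else 0) + (\<Sum>x\<in>{0<..L}. level_cost x (2 ^ K))"
      by (simp add: sum.distrib del: power_Suc)
    then show ?case using Suc level[of "2 ^ Suc K"] by (simp add: algebra_simps)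
  qed
qed

text \<open>The steps that the current phase still has to make, paid for by the update that starts it.\<close>

definition potential :: "op list \<Rightarrow> nat \<Rightarrow> nat \<Rightarrow> nat" where
  "potential P K i = (\<Sum>x\<in>{i<..length P}. level_cost x (2 ^ K) + 6)"

lemma potential_split:
  assumes "i \<le> j" "j \<le> length P"
  shows "potential P K i = (\<Sum>x\<in>{i<..j}. level_cost x (2 ^ K) + 6) + potential P K j"
proof -
  have "{i<..length P} = {i<..j} \<union> {j<..length P}" "{i<..j} \<inter> {j<..length P} = {}" using assms by auto
  then show ?thesis unfolding potential_def by (simp add: sum.union_disjoint)
qed

lemma potential_0: "potential P K 0 \<le> length P * (30 + 24 * K)"
  using sum_level_cost[of K "length P"] by (simp add: potential_def sum.distrib algebra_simps)

text \<open>
  At time \<open>i\<close> of the phase with entries \<open>P\<close>, the first \<open>h\<close> updates of \<open>qs\<close> have been handled.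
  The last conjunct makes phases start only at multiples of \<open>m\<close>, so that their costs amortize.
\<close>

definition follows :: "op list \<Rightarrow> nat \<Rightarrow> nat \<Rightarrow> op list \<Rightarrow> nat \<Rightarrow> bool" where
  "follows qs m h P i \<longleftrightarrow> graph_at P i = graph_after qs h \<and> i \<le> length P \<and> length P \<le> 2 * m \<and>
     drop i P = map norm_op (take (length P - i) (drop h qs)) \<and>
     (h + (length P - i) < length qs \<and> 0 < m \<longrightarrow> m dvd h + (length P - i))"

lemma graph_after_Suc:
  assumes "h < length qs"
  shows "graph_after qs (Suc h) = apply_op (qs ! h) (graph_after qs h)"
  using assms by (simp add: graph_after_def take_Suc_conv_app_nth)

lemma follows_Suc:
  assumes f: "follows qs m h P i" and i: "i < length P" and h: "h < length qs"
  shows "follows qs m (Suc h) P (Suc i)"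
proof -
  have dr: "drop i P = map norm_op (take (length P - i) (drop h qs))"
    using f by (simp add: follows_def)
  have "op_at P (Suc i) = hd (drop i P)" using i by (simp add: op_at_def hd_drop_conv_nth)
  also have "\<dots> = norm_op (qs ! h)"
    unfolding dr using i h by (simp add: hd_map hd_drop_conv_nth)
  finally have "graph_at P (Suc i) = graph_after qs (Suc h)"
    using f i h by (simp add: graph_at_step graph_after_Suc follows_def)
  moreover have "drop (Suc i) P = map norm_op (take (length P - Suc i) (drop (Suc h) qs))"
  proof -
    have "drop (Suc i) P = tl (drop i P)" by (simp add: drop_Suc tl_drop)
    also have "\<dots> = map norm_op (take (length P - Suc i) (drop (Suc h) qs))"
      unfolding dr by (simp add: map_tl[symmetric] tl_take drop_Suc tl_drop)
    finally show ?thesis .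
  qed
  moreover have same: "Suc h + (length P - Suc i) = h + (length P - i)" using i by simp
  ultimately show ?thesis using f i unfolding follows_def same by simp
qed

lemma fold_inserts:
  assumes "\<forall>q\<in>set E. op_kind q = 1"
  shows "fold apply_op E G = G \<union> (\<lambda>q. op_edge q) ` set E"
  using assms
proof (induction E arbitrary: G)
  case (Cons q E)
  then show ?case by (cases q) auto
qed simp

text \<open>A full window leads from one multiple of \<open>m\<close> to the next. A shorter one
  reaches the end of the stream, where the claim about divisibility is vacuous.\<close>

lemma follows_rebuild:
  assumes E: "\<forall>q\<in>set E. op_kind q = 1" "(\<lambda>q. op_edge q) ` set E = graph_after qs h" "length E \<le> m"
    and h: "m dvd h"
  shows "follows qs m h (E @ map norm_op (take m (drop h qs))) (length E)"
proof -
  have "take (length (take m (drop h qs))) (drop h qs) = take m (drop h qs)" by (simp add: min_def)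
  then show ?thesis using assms by (auto simp: follows_def graph_at_def fold_inserts)
qed

section \<open>Setup, updates and queries\<close>

context ram
begin

lemma setup_com:
  "\<exists>s t. exec N win setup_com (initial_state n) t s \<and> settled [] 0 0 s \<and> reg s 0 = 0 \<and>
     t \<le> 22 * setup_bound (alloc_model N) n"
proof -
  have nn: "n \<le> n * n" by (rule le_square)
  have W: "2 < word_bound N" "n * n < word_bound N" "2 * (n * n) < word_bound N"
    "2 * (n * n) + 2 < word_bound N" "n * n + 1 < word_bound N" "n + 1 < word_bound N"
    using word_bound_ge nn by linarith+
  let ?I = "\<lambda>s. geometry n s \<and> reg s 0 = n \<and> reg s 2 = 0 \<and> reg s 3 = 0 \<and> reg s 4 = 1 \<and>
    reg s 5 = never n \<and> reg s 7 \<le> n \<and> (\<forall>u<reg s 7. cell s 8 0 u = 0)"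
  have loop: "wp N win (While (Less (Reg 7) (Reg 0))
      (Seq (Store 8 (Const 0) (Reg 7) (Const 0)) (Assign 7 (Add (Reg 7) (Const 1))))) s
    (\<lambda>t s'. settled [] 0 0 (s'\<lparr>reg := (reg s')(0 := 0)\<rparr>) \<and> t \<le> 3 * n + 1)"
    if "?I s" "reg s 7 = 0" for s
  proof (rule wp_conseq[OF wp_While[where I = ?I and f = "\<lambda>s. 3 * (n - reg s 7)"]])
    show "?I s" by fact
  next
    fix s assume I: "?I s" and b: "holds N win s (Less (Reg 7) (Reg 0))"
    have "3 * (n - reg s 7) = 3 + 3 * (n - Suc (reg s 7))" using b I by auto
    then show "wp N win (Seq (Store 8 (Const 0) (Reg 7) (Const 0)) (Assign 7 (Add (Reg 7) (Const 1)))) s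
      (\<lambda>t s'. ?I s' \<and> 1 + t + 3 * (n - reg s' 7) \<le> 3 * (n - reg s 7))"
      using I b W by (auto simp: wp_simps geometry_def in_bounds_def less_Suc_eq)
  next
    fix t s' assume *: "?I s' \<and> \<not> holds N win s' (Less (Reg 7) (Reg 0)) \<and> t + 3 * (n - reg s' 7) \<le> 3 * (n - reg s 7) + 1"
    then have "reg s' 7 = n" by auto
    then have "level_inv [] n 0 0 0 (cell s' 8 0) (cell s' 9 0)" using * by (intro level_inv_start) simp
    then have "settled [] 0 0 (s'\<lparr>reg := (reg s')(0 := 0)\<rparr>)"
      using * by (auto simp: settled_def phase_inv_def time_inv_def geometry_def normal_ops_def)
    then show "settled [] 0 0 (s'\<lparr>reg := (reg s')(0 := 0)\<rparr>) \<and> t \<le> 3 * n + 1" using * that(2) by auto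
  qed
  have "wp N win setup_com (initial_state n) (\<lambda>t s. settled [] 0 0 s \<and> reg s 0 = 0 \<and>
     t \<le> 22 * setup_bound (alloc_model N) n)"
    unfolding setup_com_def
    using W apply (simp add: wp_simps wp_Alloc initial_state_def alloc_def del: One_nat_def)
    apply (rule wp_conseq[OF loop])
      apply (simp add: geometry_def never_def)
     apply simp
    subgoal for t s'
      by (cases "alloc_model N") (auto simp: power2_eq_square, use nn in linarith)
    done
  then show ?thesis unfolding wp_def by blast
qed

text \<open>Starting a phase costs at most \<open>26 * m + 40 * m\<close> for rebuilding, as old and
  new entries number at most \<open>2 * m\<close> each, and creates a potential of at most
  \<open>60 * m + 48 * \<kappa> * m\<close>. Any other update is paid by the drop of the potential,
  up to a constant. The 16 is what the constants 3, 12 and 1 at a phase start amount to.\<close>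

lemma update_com:
  assumes s: "settled P K i s" and reg0: "reg s 0 = 0" and f: "follows qs m h P i" and h: "h < length qs"
    and qs: "\<forall>q\<in>set qs. valid_op n q" "2 * m \<le> n * n"
    and G: "\<And>j. card (graph_after qs j) \<le> m" "\<And>j. finite (graph_after qs j)"
    and \<kappa>: "\<And>K. 2 ^ K \<le> 2 * m + 1 \<Longrightarrow> K \<le> \<kappa>"
  shows "\<exists>t s' P' K' i'. exec N (take m (drop h qs)) update_com s t s' \<and>
     settled P' K' i' s' \<and> reg s' 0 = 0 \<and> follows qs m (Suc h) P' i' \<and>
     t + potential P' K' i' \<le> potential P K i + (16 + (if m dvd h then (126 + 48 * \<kappa>) * m else 0))"
proof -
  let ?win = "take m (drop h qs)"
  let ?goal = "\<lambda>t s'. \<exists>P' K' i'. settled P' K' i' s' \<and> reg s' 0 = 0 \<and> follows qs m (Suc h) P' i' \<and>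
     t + potential P' K' i' \<le> potential P K i + (16 + (if m dvd h then (126 + 48 * \<kappa>) * m else 0))"
  have noop: "s\<lparr>reg := (reg s)(0 := 0)\<rparr> = s" using reg0 by (simp add: fun_upd_idem)
  have W: "1 < word_bound N" using word_bound_ge by linarith
  have reg0': "reg s' 0 = 0"
    if "exec N ?win advance_prog s2 t2 s'" "reg s2 0 = 0" for s2 t2 s'
    using exec_reg[OF that(1), of 0] that(2)
    by (simp add: advance_prog_def step_prog_def level_loop_def candidate_loop_def candidate_body_def)
  have "wp N ?win update_com s ?goal"
  proof (cases "m = 0")
    case True
    then have "P = []" "i = 0" using f by (auto simp: follows_def)
    moreover have "graph_after qs (Suc h) = {}" using G[of "Suc h"] True by simp
    ultimately have "follows qs m (Suc h) P i" using True by (simp add: follows_def)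
    then have "?goal 3 s" using s reg0 by (intro exI[of _ P] exI[of _ K] exI[of _ i]) simp
    then show ?thesis using True noop
      by (simp add: update_com_def wp_simps inspect_def del: One_nat_def)
  next
    case False
    then have win0: "0 < length ?win" using h by simp
    then have kind: "op_kind (?win ! 0) \<noteq> 0" using op_kind_cases[of "?win ! 0"] by auto
    have regs: "reg s 2 = i" "reg s 3 = length P" and iP: "i \<le> length P"
      using s by (auto simp: settled_def phase_inv_def time_inv_def)
    have branch: "wp N ?win update_com s ?goal \<longleftrightarrow>
       (if i = length P then wp N ?win rebuild_prog s (\<lambda>t1 s1. wp N ?win advance_prog s1 (\<lambda>t2. ?goal (1 + (1 + (1 + t1 + t2)))))
        else wp N ?win advance_prog (s\<lparr>reg := (reg s)(6 := (i + 1) mod word_bound N)\<rparr>) (\<lambda>t2. ?goal (1 + (1 + (1 + 1 + t2)))))"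
      using False win0 kind noop regs W
      by (simp add: update_com_def wp_simps inspect_def del: One_nat_def)
    show ?thesis
    proof (cases "i = length P")
      case False
      then have i: "i < length P" using iP by simp
      have "length P \<le> n * n" using f qs(2) by (simp add: follows_def)
      then have iW: "(i + 1) mod word_bound N = Suc i" using word_bound_ge i by simp
      let ?s = "s\<lparr>reg := (reg s)(6 := Suc i)\<rparr>"
      have "settled P K i ?s"
        using s phase_inv_cong[of n K P s ?s] time_inv_cong[of n P i s ?s] by (simp add: settled_def)
      from advance_prog[OF this] i
      have adv: "wp N ?win advance_prog ?s (\<lambda>t s'. settled P K (Suc i) s' \<and>
        t \<le> (\<Sum>x\<in>{i<..Suc i}. level_cost x (2 ^ K) + 6) + 1)" by simp
      have "wp N ?win advance_prog ?s (\<lambda>t2. ?goal (1 + (1 + (1 + 1 + t2))))"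
      proof (rule wp_conseq[OF adv], elim conjE)
        fix t s'
        assume e: "exec N ?win advance_prog ?s t s'" and s': "settled P K (Suc i) s'"
          and t: "t \<le> (\<Sum>x\<in>{i<..Suc i}. level_cost x (2 ^ K) + 6) + 1"
        have "reg s' 0 = 0" using reg0'[OF e] reg0 by simp
        moreover have "1 + (1 + (1 + 1 + t)) + potential P K (Suc i) \<le> potential P K i + 16"
          using t potential_split[of i "Suc i" P K] i by simp
        ultimately show "?goal (1 + (1 + (1 + 1 + t))) s'"
          using s' follows_Suc[OF f i h] by (intro exI[of _ P] exI[of _ K] exI[of _ "Suc i"]) simp
      qed
      then show ?thesis using branch False iW by simp
    next
      case True
      have "m dvd h" using f h True \<open>m \<noteq> 0\<close> by (simp add: follows_def)
      have graph: "graph_at P (length P) = graph_after qs h" using f True by (simp add: follows_def)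
      have "\<forall>q\<in>set ?win. valid_op n q" using qs(1) by (meson in_set_dropD in_set_takeD)
      moreover have "card (graph_at P (length P)) + length ?win \<le> n * n"
        using G(1)[of h] qs(2) graph by simp
      ultimately have reb: "wp N ?win rebuild_prog s (\<lambda>t s'. \<exists>E K'. settled (E @ map norm_op ?win) K' 0 s' \<and>
        (\<forall>q\<in>set E. op_kind q = 1) \<and> (\<lambda>q. op_edge q) ` set E = graph_after qs h \<and>
        length E = card (graph_after qs h) \<and> reg s' 6 = length E + 1 \<and>
        t \<le> 13 * length P + 20 * (length E + length ?win) + 12)"
        using rebuild_prog[of P K s ?win] s True graph by simp
      have "wp N ?win rebuild_prog s (\<lambda>t1 s1. wp N ?win advance_prog s1 (\<lambda>t2. ?goal (1 + (1 + (1 + t1 + t2)))))"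
      proof (rule wp_conseq[OF reb], elim exE conjE)
        fix t1 s1 E K'
        let ?P = "E @ map norm_op ?win"
        assume e1: "exec N ?win rebuild_prog s t1 s1" and s1: "settled ?P K' 0 s1"
          and E: "\<forall>q\<in>set E. op_kind q = 1" "(\<lambda>q. op_edge q) ` set E = graph_after qs h"
            "length E = card (graph_after qs h)"
          and r6: "reg s1 6 = length E + 1" and t1: "t1 \<le> 13 * length P + 20 * (length E + length ?win) + 12"
        have lenE: "length E \<le> m" using E(3) G by simp
        have fE: "follows qs m h ?P (length E)" by (rule follows_rebuild[OF E(1,2) lenE \<open>m dvd h\<close>])
        have lt: "length E < length ?P" using win0 by simp
        have r0: "reg s1 0 = 0"
          using exec_reg[OF e1, of 0] reg0
          by (simp add: rebuild_prog_def compact_prog_def compact_body_def append_prog_def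
              append_body_def width_prog_def deletion_prog_def deletion_body_def)
        have "0 \<le> reg s1 6" "reg s1 6 \<le> length ?P" using r6 lt by linarith+
        from advance_prog[OF s1 this]
        show "wp N ?win advance_prog s1 (\<lambda>t2. ?goal (1 + (1 + (1 + t1 + t2))))"
        proof (rule wp_conseq, elim conjE)
          fix t2 s2
          assume e2: "exec N ?win advance_prog s1 t2 s2" and s2: "settled ?P K' (reg s1 6) s2"
            and t2: "t2 \<le> (\<Sum>x\<in>{0<..reg s1 6}. level_cost x (2 ^ K') + 6) + 1"
          have arith: "1 + (1 + (1 + t1 + t2)) + q \<le> 16 + (126 + 48 * \<kappa>) * m"
            if "t1 \<le> 13 * a + 20 * b + 12" "a \<le> 2 * m" "b \<le> 2 * m" "t2 \<le> S + 1" "p = S + q"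
              "p \<le> 60 * m + 48 * \<kappa> * m" for a b S p q :: nat
            using that unfolding add_mult_distrib by linarith
          have "2 ^ K' \<le> length ?P + 1" using s1 unfolding settled_def phase_inv_def by blast
          moreover have lenP: "length ?P \<le> 2 * m" "length P \<le> 2 * m"
            using fE f unfolding follows_def by auto
          ultimately have "K' \<le> \<kappa>" using \<kappa>[of K'] by linarith
          then have "length ?P * (30 + 24 * K') \<le> 2 * m * (30 + 24 * \<kappa>)"
            using lenP(1) by (intro mult_mono) simp_all
          then have "potential ?P K' 0 \<le> 60 * m + 48 * \<kappa> * m"
            using potential_0[of ?P K'] by (simp add: algebra_simps)
          moreover have "potential ?P K' 0 = (\<Sum>x\<in>{0<..reg s1 6}. level_cost x (2 ^ K') + 6) + potential ?P K' (reg s1 6)"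
            using potential_split[OF \<open>0 \<le> reg s1 6\<close> \<open>reg s1 6 \<le> length ?P\<close>] .
          moreover have "length E + length ?win \<le> 2 * m" using lenP(1) by simp
          ultimately have "1 + (1 + (1 + t1 + t2)) + potential ?P K' (reg s1 6) \<le> 16 + (126 + 48 * \<kappa>) * m"
            using arith[OF t1 lenP(2) _ t2] by simp
          then show "?goal (1 + (1 + (1 + t1 + t2))) s2"
            using s2 r6 reg0'[OF e2 r0] follows_Suc[OF fE lt h] \<open>m dvd h\<close>
            by (intro exI[of _ ?P] exI[of _ K'] exI[of _ "Suc (length E)"]) simp
        qed
      qed
      then show ?thesis using branch True by simp
    qed
  qed
  then show ?thesis unfolding wp_def by blast
qed

lemma query_com:
  assumes s: "settled P K i s" and u: "u < n"
    and same: "cell s' = cell s" "rows s' = rows s" "cols s' = cols s" "reg s' 2 = reg s 2" "reg s' 0 = u"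
  shows "exec N win query_com s' 2 (s'\<lparr>reg := (reg s')(0 :=
     encode_mate (mate (matching_of n (reg s 2) (cell s 8 0) (cell s 9 0)) u))\<rparr>)"
proof -
  have "reg s 2 = i" and geo: "geometry n s'" and m: "matched_ok P n i (cell s 8 0) (cell s 9 0)"
    using s same unfolding settled_def phase_inv_def time_inv_def level_inv_def geometry_def by auto
  then have "wp N win query_com s' (\<lambda>t s''. t = 2 \<and> s'' = s'\<lparr>reg := (reg s')(0 :=
     encode_mate (mate (matching_of n (reg s 2) (cell s 8 0) (cell s 9 0)) u))\<rparr>)"
    using same u word_bound_ge encode_mate_matching_of[OF m u]
    by (simp add: query_com_def wp_simps Let_def in_bounds_def geometry_def)
  then show ?thesis unfolding wp_def by blast
qed

lemma maximal_settled:
  assumes "settled P K i s"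
  shows "maximal_matching (graph_at P i) (matching_of n (reg s 2) (cell s 8 0) (cell s 9 0))"
proof -
  have lv: "level_inv P n K i 0 (cell s 8 0) (cell s 9 0)" and norm: "normal_ops n P" and "reg s 2 = i"
    using assms unfolding settled_def phase_inv_def time_inv_def by auto
  have "e \<subseteq> {..<n}" if e: "e \<in> graph_at P i" for e
  proof -
    obtain t where t: "1 \<le> t" "t \<le> length P" "e = op_edge (op_at P t)" using graph_at_edges[OF e] by blast
    then show ?thesis using normal_ops_at[OF norm t(1,2)] by auto
  qed
  then show ?thesis using maximal_matching_of[OF lv] \<open>reg s 2 = i\<close> by simp
qed

end

section \<open>Bounds on the number of edges and on the phase starts\<close>

lemma finite_card_graph_after: "finite (graph_after qs i) \<and> card (graph_after qs i) \<le> length (take i qs)"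
proof -
  have "finite (fold apply_op xs G) \<and> card (fold apply_op xs G) \<le> card G + length xs" if "finite G" for xs G
    using that
  proof (induction xs arbitrary: G)
    case (Cons q xs)
    have "finite (apply_op q G) \<and> card (apply_op q G) \<le> Suc (card G)"
      using Cons.prems by (cases q) (auto intro: card_insert_le_m1 le_trans[OF card_Diff1_le] simp: card_insert_if)
    then show ?case using Cons.IH[of "apply_op q G"] by auto
  qed simp
  from this[of "{}" "take i qs"] show ?thesis by (simp add: graph_after_def)
qed

lemma graph_after_edges:
  assumes "\<forall>q\<in>set qs. valid_op n q"
  shows "graph_after qs i \<subseteq> {e. e \<subseteq> {..<n} \<and> card e = 2}"
proof -
  have "fold apply_op xs G \<subseteq> {e. e \<subseteq> {..<n} \<and> card e = 2}"
    if "\<forall>q\<in>set xs. valid_op n q" "G \<subseteq> {e. e \<subseteq> {..<n} \<and> card e = 2}" for xs G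
    using that
  proof (induction xs arbitrary: G)
    case (Cons q xs)
    then have "apply_op q G \<subseteq> {e. e \<subseteq> {..<n} \<and> card e = 2}" by (cases q) auto
    then show ?case using Cons by simp
  qed simp
  moreover have "\<forall>q\<in>set (take i qs). valid_op n q" using assms by (meson in_set_takeD)
  ultimately show ?thesis unfolding graph_after_def by blast
qed

lemma max_edges_bounds:
  assumes "\<forall>q\<in>set qs. valid_op n q"
  shows "card (graph_after qs i) \<le> max_edges qs" "max_edges qs \<le> length qs" "2 * max_edges qs \<le> n * n"
proof -
  let ?S = "(\<lambda>i. card (graph_after qs i)) ` {0..length qs}"
  have "graph_after qs i = graph_after qs (min i (length qs))" by (simp add: graph_after_def min_def)
  then have "card (graph_after qs i) \<in> ?S" by (metis atLeastAtMost_iff imageI min.cobounded2 zero_le)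
  then show "card (graph_after qs i) \<le> max_edges qs" unfolding max_edges_def by (intro Max_ge) auto
  have "max_edges qs \<in> ?S" unfolding max_edges_def by (rule Max_in) auto
  then obtain j where j: "max_edges qs = card (graph_after qs j)" by auto
  show "max_edges qs \<le> length qs" unfolding j using finite_card_graph_after[of qs j] by simp
  have "card (graph_after qs j) \<le> card {e. e \<subseteq> {..<n} \<and> card e = 2}"
    by (rule card_mono[OF _ graph_after_edges[OF assms]]) (simp add: finite_Collect_conjI)
  also have "\<dots> = n choose 2" using n_subsets[of "{..<n}" 2] by simp
  finally have "2 * max_edges qs \<le> 2 * (n choose 2)" using j by simp
  also have "\<dots> \<le> n * (n - 1)" by (simp add: choose_two)
  also have "\<dots> \<le> n * n" by simp
  finally show "2 * max_edges qs \<le> n * n" .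
qed

lemma total_update_time_Nil: "total_update_time [] out = 0"
  by (simp add: total_update_time_def)

lemma total_update_time_Cons:
  "total_update_time (e # es) (x # out) = (if is_update e then fst x else 0) + total_update_time es out"
proof -
  have eq: "total_update_time es out = (\<Sum>i<length es. if is_update (es ! i) then fst (out ! i) else 0)" for es out
    unfolding total_update_time_def by (subst sum.inter_filter[symmetric]) (auto intro: sum.cong)
  show ?thesis unfolding eq by (auto simp: sum.lessThan_Suc_shift simp del: sum.lessThan_Suc intro!: sum.cong)
qed

text \<open>The start at 0 contributes \<open>b * m\<close>, at most \<open>b * L\<close> by
  assumption; the starts at positive multiples of \<open>m\<close> contribute at most
  \<open>b * L\<close> together.\<close>

lemma sum_phase_starts:
  assumes "m \<le> L"
  shows "(\<Sum>h<L. if m dvd h then b * m else 0) \<le> 2 * b * (L::nat)"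
proof (cases "L = 0")
  case False
  have "(\<Sum>h<L. if m dvd h then m else 0) \<le> m + (\<Sum>h\<in>{0<..L}. if m dvd h then m else 0)"
  proof -
    have "(\<Sum>h<L. if m dvd h then m else 0) \<le> (\<Sum>h\<in>insert 0 {0<..L}. if m dvd h then m else 0)"
      by (rule sum_mono2) auto
    then show ?thesis by simp
  qed
  also have "\<dots> \<le> 2 * L" using sum_multiples[where w = m and L = L] assms by linarith
  finally have "b * (\<Sum>h<L. if m dvd h then m else 0) \<le> b * (2 * L)" by (rule mult_le_mono2)
  moreover have "(\<Sum>h<L. if m dvd h then b * m else 0) = b * (\<Sum>h<L. if m dvd h then m else 0)"
    unfolding sum_distrib_left by (rule sum.cong) auto
  ultimately show ?thesis by (simp add: algebra_simps)
qed simp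

context ram
begin

text \<open>
  Queries change register 0 only and updates start by clearing it, so up to register 0 the states
  form one chain \<open>S\<close> that does not depend on where the queries occur.
\<close>

lemma run_exists:
  assumes upd: "\<And>h. h < length qs \<Longrightarrow> exec N (take m (drop h qs)) update_com (S h) (T h) (S (Suc h))"
    and settled: "\<And>h. h \<le> length qs \<Longrightarrow> \<exists>P K i. settled P K i (S h)"
    and reg0: "\<And>h. h \<le> length qs \<Longrightarrow> reg (S h) 0 = 0"
    and A: "update_prog A = update_com" "query_prog A = query_com"
    and M: "\<And>h. M h = matching_of n (reg (S h) 2) (cell (S h) 8 0) (cell (S h) 9 0)"
  shows "h \<le> length qs \<Longrightarrow> updates es = drop h qs \<Longrightarrow> \<forall>u. Query u \<in> set es \<longrightarrow> u < n \<Longrightarrow>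
     s\<lparr>reg := (reg s)(0 := 0)\<rparr> = S h \<Longrightarrow>
     \<exists>out. run A N m s es out \<and> total_update_time es out = (\<Sum>x\<in>{h..<length qs}. T x) \<and>
       (\<forall>j u. j < length es \<longrightarrow> es ! j = Query u \<longrightarrow> fst (out ! j) \<le> 2 \<and>
          snd (out ! j) = encode_mate (mate (M (h + length (updates (take j es)))) u))"
proof (induction es arbitrary: h s)
  case Nil
  then show ?case by (intro exI[of _ "[]"]) (simp add: run.Nil total_update_time_Nil)
next
  case (Cons e es)
  show ?case
  proof (cases e)
    case (Update q)
    then have q: "q # updates es = drop h qs" using Cons.prems(2) by simp
    then have h: "h < length qs" by (metis drop_all list.distinct(1) not_le)
    have rest: "updates es = drop (Suc h) qs"
      using arg_cong[OF q, of tl] by (simp add: drop_Suc tl_drop)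
    have "exec N (take m (q # updates es)) update_com (S h) (T h) (S (Suc h))"
      using upd[OF h] q by simp
    moreover have "(S h)\<lparr>reg := (reg (S h))(0 := 0)\<rparr> = S h"
      using reg0[of h] h by (simp add: fun_upd_idem)
    ultimately have ex: "exec N (take m (q # updates es)) update_com s (T h) (S (Suc h))"
    proof -
      let ?c = "If (Equal (Op_Kind (Const 0)) (Const 0)) Skip
         (Seq (If (Equal (Reg 2) (Reg 3)) rebuild_prog (Assign 6 (Add (Reg 2) (Const 1)))) advance_prog)"
      have step: "wp N (take m (q # updates es)) update_com s' Q \<longleftrightarrow>
        wp N (take m (q # updates es)) ?c (s'\<lparr>reg := (reg s')(0 := 0)\<rparr>) (\<lambda>t. Q (1 + t))" for s' Q
        by (simp add: update_com_def wp_Seq wp_Assign)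
      assume "exec N (take m (q # updates es)) update_com (S h) (T h) (S (Suc h))"
        and same: "(S h)\<lparr>reg := (reg (S h))(0 := 0)\<rparr> = S h"
      then have "wp N (take m (q # updates es)) update_com (S h) (\<lambda>t s'. t = T h \<and> s' = S (Suc h))"
        unfolding wp_def by blast
      then have "wp N (take m (q # updates es)) update_com s (\<lambda>t s'. t = T h \<and> s' = S (Suc h))"
        unfolding step same Cons.prems(4) .
      then show ?thesis unfolding wp_def by blast
    qed
    have "(S (Suc h))\<lparr>reg := (reg (S (Suc h)))(0 := 0)\<rparr> = S (Suc h)"
      using reg0[of "Suc h"] h by (simp add: fun_upd_idem)
    moreover have "\<forall>u. Query u \<in> set es \<longrightarrow> u < n" using Cons.prems(3) by simp
    ultimately obtain out where
      out: "run A N m (S (Suc h)) es out" "total_update_time es out = (\<Sum>x\<in>{Suc h..<length qs}. T x)"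
      "\<And>j u. j < length es \<Longrightarrow> es ! j = Query u \<Longrightarrow> fst (out ! j) \<le> 2 \<and>
          snd (out ! j) = encode_mate (mate (M (Suc h + length (updates (take j es)))) u)"
      using Cons.IH[OF Suc_leI[OF h] rest] by blast
    have "run A N m s (e # es) ((T h, reg (S (Suc h)) 0) # out)"
      unfolding Update by (rule run.Update[OF _ out(1)]) (simp add: A ex)
    moreover have "(\<Sum>x\<in>{h..<length qs}. T x) = T h + (\<Sum>x\<in>{Suc h..<length qs}. T x)"
      using h by (rule sum.atLeast_Suc_lessThan)
    ultimately show ?thesis
      using out(2,3) Update
      by (intro exI[of _ "(T h, reg (S (Suc h)) 0) # out"])
        (auto simp: total_update_time_Cons nth_Cons split: nat.splits)
  next
    case (Query u)
    have u: "u < n" using Cons.prems(3) Query by simp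
    obtain P K i where st: "settled P K i (S h)" using settled Cons.prems(1) by blast
    let ?a = "encode_mate (mate (M h) u)"
    let ?s = "s\<lparr>reg := (reg s)(0 := u)\<rparr>"
    let ?s' = "?s\<lparr>reg := (reg ?s)(0 := ?a)\<rparr>"
    have same: "cell ?s = cell (S h)" "rows ?s = rows (S h)" "cols ?s = cols (S h)"
      "reg ?s 2 = reg (S h) 2" "reg ?s 0 = u"
      unfolding Cons.prems(4)[symmetric] by simp_all
    have ex: "exec N (take m (updates es)) query_com ?s 2 ?s'"
      using query_com[OF st u same] unfolding M .
    have "?s'\<lparr>reg := (reg ?s')(0 := 0)\<rparr> = S h" unfolding Cons.prems(4)[symmetric] by simp
    moreover have "\<forall>u. Query u \<in> set es \<longrightarrow> u < n" "updates es = drop h qs"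
      using Cons.prems(2,3) Query by simp_all
    ultimately obtain out where
      out: "run A N m ?s' es out" "total_update_time es out = (\<Sum>x\<in>{h..<length qs}. T x)"
      "\<And>j u. j < length es \<Longrightarrow> es ! j = Query u \<Longrightarrow> fst (out ! j) \<le> 2 \<and>
          snd (out ! j) = encode_mate (mate (M (h + length (updates (take j es)))) u)"
      using Cons.IH[OF Cons.prems(1)] by blast
    have "run A N m s (e # es) ((2, reg ?s' 0) # out)"
      unfolding Query by (rule run.Query[OF _ out(1)]) (use ex A in simp)
    then show ?thesis
      using out(2,3) Query
      by (intro exI[of _ "(2, ?a) # out"])
        (auto simp: total_update_time_Cons nth_Cons split: nat.splits)
  qed
qed

end

section \<open>Assembling the algorithm and the final bound\<close>

definition matching_algorithm :: algorithm where
  "matching_algorithm = \<lparr>setup_prog = setup_com, update_prog = update_com, query_prog = query_com\<rparr>"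

lemma update_chain:
  assumes W: "(n + 2) ^ 4 \<le> word_bound N" and qs: "\<forall>q\<in>set qs. valid_op n q"
    and \<kappa>: "\<And>K. 2 ^ K \<le> 2 * max_edges qs + 1 \<Longrightarrow> K \<le> \<kappa>"
  shows "\<exists>s0 t0 S T. exec N (take (max_edges qs) qs) setup_com (initial_state n) t0 s0 \<and>
     t0 \<le> 22 * setup_bound (alloc_model N) n \<and> S 0 = s0 \<and>
     (\<forall>h < length qs. exec N (take (max_edges qs) (drop h qs)) update_com (S h) (T h) (S (Suc h))) \<and>
     (\<forall>h \<le> length qs. reg (S h) 0 = 0 \<and> (\<exists>P K i. ram.settled n P K i (S h) \<and> graph_at P i = graph_after qs h)) \<and>
     (\<Sum>h<length qs. T h) \<le> 16 * length qs + 2 * (126 + 48 * \<kappa>) * length qs"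
proof -
  \<comment> \<open>The quadratic term of the fourth power is \<open>24 * n * n\<close> and the
    constant term 16, which together exceed the bound that the locale asks for.\<close>
  have "(n + 2) ^ 4 = 8 * (n * n) + 16 + (n * n * n * n + 8 * n * n * n + 16 * n * n + 32 * n)"
    by (simp add: power4_eq_xxxx algebra_simps)
  then interpret ram N n using W by unfold_locales linarith
  define m where "m = max_edges qs"
  define cost where "cost h = 16 + (if m dvd h then (126 + 48 * \<kappa>) * m else 0)" for h
  note bounds = max_edges_bounds[OF qs, folded m_def]
  obtain s0 t0 where init: "exec N (take m qs) setup_com (initial_state n) t0 s0" "settled [] 0 0 s0"
    "reg s0 0 = 0" "t0 \<le> 22 * setup_bound (alloc_model N) n" using setup_com by blast
  define Inv where "Inv h = (\<lambda>(s, p, t :: nat). h \<le> length qs \<longrightarrow> (h = 0 \<longrightarrow> s = s0 \<and> p = 0) \<and> reg s 0 = 0 \<and>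
    (\<exists>P K i. settled P K i s \<and> follows qs m h P i \<and> p = potential P K i))" for h
  define Step where "Step h = (\<lambda>(s, p :: nat, t :: nat) (s', p', t'). h < length qs \<longrightarrow>
    exec N (take m (drop h qs)) update_com s t' s' \<and> t' + p' \<le> p + cost h)" for h
  \<comment> \<open>The potential belongs to phase data that exist only as witnesses, so state,
    potential and time are chosen together, one update after the other. The time stored at index
    \<open>h + 1\<close> is that of update \<open>h\<close>.\<close>
  have "\<exists>f. \<forall>h. Inv h (f h) \<and> Step h (f h) (f (Suc h))"
  proof (rule dependent_nat_choice)
    have "follows qs m 0 [] 0" by (simp add: follows_def graph_after_def)
    then have "Inv 0 (s0, 0, 0)"
      using init unfolding Inv_def by (auto intro!: exI[of _ "[]"] exI[of _ 0] simp: potential_def)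
    then show "\<exists>x. Inv 0 x" ..
  next
    fix x :: "state \<times> nat \<times> nat" and h assume x: "Inv h x"
    obtain s p t where x_def: "x = (s, p, t)" by (cases x)
    show "\<exists>y. Inv (Suc h) y \<and> Step h x y"
    proof (cases "h < length qs")
      case False
      then show ?thesis by (intro exI[of _ x]) (auto simp: Inv_def Step_def x_def)
    next
      case True
      then obtain P K i where I: "settled P K i s" "reg s 0 = 0" "follows qs m h P i" "p = potential P K i"
        using x by (auto simp: Inv_def x_def)
      have "\<exists>t s' P' K' i'. exec N (take m (drop h qs)) update_com s t s' \<and>
         settled P' K' i' s' \<and> reg s' 0 = 0 \<and> follows qs m (Suc h) P' i' \<and>
         t + potential P' K' i' \<le> potential P K i + cost h"
        unfolding cost_def
        by (rule update_com[OF I(1,2,3) True qs bounds(3,1)])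
          (use finite_card_graph_after \<kappa> in \<open>auto simp: m_def\<close>)
      then obtain t' s' P' K' i' where "exec N (take m (drop h qs)) update_com s t' s'"
         "settled P' K' i' s'" "reg s' 0 = 0" "follows qs m (Suc h) P' i'"
         "t' + potential P' K' i' \<le> potential P K i + cost h" by blast
      then show ?thesis
        using I(4) by (intro exI[of _ "(s', potential P' K' i', t')"]) (auto simp: Inv_def Step_def x_def)
    qed
  qed
  then obtain f where f: "\<And>h. Inv h (f h)" "\<And>h. Step h (f h) (f (Suc h))" by blast
  define S where "S h = fst (f h)" for h
  define T where "T h = snd (snd (f (Suc h)))" for h
  define p where "p h = fst (snd (f h))" for h
  have f_eq: "f h = (S h, p h, snd (snd (f h)))" for h by (simp add: S_def p_def)
  have step: "exec N (take m (drop h qs)) update_com (S h) (T h) (S (Suc h))" "T h + p (Suc h) \<le> p h + cost h"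
    if "h < length qs" for h
    using f(2)[of h] that f_eq[of h] f_eq[of "Suc h"] unfolding Step_def T_def by (auto split: prod.splits)
  have inv: "reg (S h) 0 = 0" "\<exists>P K i. settled P K i (S h) \<and> graph_at P i = graph_after qs h"
    if "h \<le> length qs" for h
    using f(1)[of h] that f_eq[of h] unfolding Inv_def follows_def by (auto split: prod.splits)
  have S0: "S 0 = s0" "p 0 = 0" using f(1)[of 0] f_eq[of 0] unfolding Inv_def by (auto split: prod.splits)
  \<comment> \<open>Telescoping of the potential, which is 0 before the first update.\<close>
  have "(\<Sum>h<k. T h) + p k \<le> (\<Sum>h<k. cost h)" if "k \<le> length qs" for k
    using that
  proof (induction k)
    case (Suc k)
    then show ?case using step(2)[of k] by simp
  qed (simp add: S0)
  then have "(\<Sum>h<length qs. T h) \<le> (\<Sum>h<length qs. cost h)" by (meson add_leD1 le_refl)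
  also have "\<dots> = 16 * length qs + (\<Sum>h<length qs. if m dvd h then (126 + 48 * \<kappa>) * m else 0)"
    by (simp add: cost_def sum.distrib)
  also have "\<dots> \<le> 16 * length qs + 2 * (126 + 48 * \<kappa>) * length qs"
    by (rule add_left_mono[OF sum_phase_starts[OF bounds(2)]])
  finally have "(\<Sum>h<length qs. T h) \<le> 16 * length qs + 2 * (126 + 48 * \<kappa>) * length qs" .
  then show ?thesis
    using init step(1) inv S0(1) unfolding m_def by blast
qed

text \<open>From \<open>2 ^ K \<le> 2 * (m + 2)\<close> the exponent exceeds the logarithm of
  \<open>m + 2\<close> by at most 1. The shift by 2 keeps this logarithm at least 1 even for
  \<open>m = 0\<close>, so that it absorbs additive constants.\<close>

lemma log_bound:
  fixes m :: nat
  defines "\<kappa> \<equiv> nat \<lfloor>log 2 (real m + 2)\<rfloor> + 1"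
  shows "2 ^ K \<le> 2 * m + 1 \<Longrightarrow> K \<le> \<kappa>" and "real \<kappa> \<le> log 2 (real m + 2) + 1" and "1 \<le> log 2 (real m + 2)"
proof -
  show 1: "1 \<le> log 2 (real m + 2)" by simp
  then show "real \<kappa> \<le> log 2 (real m + 2) + 1" unfolding \<kappa>_def by linarith
  assume "2 ^ K \<le> 2 * m + 1"
  then have "real (2 ^ K) \<le> real (2 * m + 1)" by (rule of_nat_mono)
  then have "2 ^ K \<le> 2 * (real m + 2)" by simp
  then have "log 2 (2 ^ K) \<le> log 2 (2 * (real m + 2))" by (intro log_mono) auto
  also have "\<dots> = 1 + log 2 (real m + 2)" by (subst log_mult) auto
  finally have "real K \<le> 1 + log 2 (real m + 2)" by (simp add: log_nat_power)
  then show "K \<le> \<kappa>" unfolding \<kappa>_def using 1 by linarith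
qed

theorem theorem2:
  shows "\<exists>(A :: algorithm) (C :: nat) (k :: nat).
    \<forall>(n :: nat) (N :: machine) (qs :: op list).
      (n + 2) ^ k \<le> word_bound N \<longrightarrow>
      (\<forall>q \<in> set qs. valid_op n q) \<longrightarrow>
      (let m = max_edges qs in
        \<exists>s\<^sub>0 t\<^sub>0.
          exec N (take m qs) (setup_prog A) (initial_state n) t\<^sub>0 s\<^sub>0 \<and>
          t\<^sub>0 \<le> C * setup_bound (alloc_model N) n \<and>
          (\<exists>M :: nat \<Rightarrow> edge set.
            (\<forall>i \<le> length qs. maximal_matching (graph_after qs i) (M i)) \<and>
            (\<forall>es :: event list.
              updates es = qs \<longrightarrow>
              (\<forall>u. Query u \<in> set es \<longrightarrow> u < n) \<longrightarrow>
              (\<exists>out.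
                run A N m s\<^sub>0 es out \<and>
                real (total_update_time es out) \<le> real C * real (length qs) * log 2 (real m + 2) \<and>
                (\<forall>j u. j < length es \<longrightarrow> es ! j = Query u \<longrightarrow>
                  fst (out ! j) \<le> C \<and>
                  snd (out ! j) = encode_mate (mate (M (length (updates (take j es)))) u))))))"
proof (rule exI[of _ matching_algorithm], rule exI[of _ 500], rule exI[of _ 4],
    intro allI impI, unfold Let_def)
  fix n :: nat and N :: machine and qs :: "op list"
  assume W: "(n + 2) ^ 4 \<le> word_bound N" and qs: "\<forall>q\<in>set qs. valid_op n q"
  let ?m = "max_edges qs"
  let ?A = matching_algorithm
  define \<kappa> where "\<kappa> = nat \<lfloor>log 2 (real ?m + 2)\<rfloor> + 1"
  note \<kappa> = log_bound[where m = ?m, folded \<kappa>_def]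
  obtain s0 t0 S T where init: "exec N (take ?m qs) setup_com (initial_state n) t0 s0"
      "t0 \<le> 22 * setup_bound (alloc_model N) n" "S 0 = s0"
    and upd: "\<And>h. h < length qs \<Longrightarrow> exec N (take ?m (drop h qs)) update_com (S h) (T h) (S (Suc h))"
    and inv: "\<And>h. h \<le> length qs \<Longrightarrow> reg (S h) 0 = 0"
      "\<And>h. h \<le> length qs \<Longrightarrow> \<exists>P K i. ram.settled n P K i (S h) \<and> graph_at P i = graph_after qs h"
    and time: "(\<Sum>h<length qs. T h) \<le> 16 * length qs + 2 * (126 + 48 * \<kappa>) * length qs"
    using update_chain[OF W qs \<kappa>(1)] by blast
  have "(n + 2) ^ 4 = 8 * (n * n) + 16 + (n * n * n * n + 8 * n * n * n + 16 * n * n + 32 * n)"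
    by (simp add: power4_eq_xxxx algebra_simps)
  then interpret ram N n using W by unfold_locales linarith
  define M where "M h = matching_of n (reg (S h) 2) (cell (S h) 8 0) (cell (S h) 9 0)" for h
  have max: "\<forall>i\<le>length qs. maximal_matching (graph_after qs i) (M i)"
    using inv(2) maximal_settled unfolding M_def by metis
  have cost: "real (\<Sum>h<length qs. T h) \<le> real 500 * real (length qs) * log 2 (real ?m + 2)"
  proof -
    have "real (\<Sum>h<length qs. T h) \<le> real (16 * length qs + 2 * (126 + 48 * \<kappa>) * length qs)"
      using time by (rule of_nat_mono)
    also have "\<dots> = real (length qs) * (268 + 96 * real \<kappa>)" by (simp add: algebra_simps)
    \<comment> \<open>As \<open>\<kappa>\<close> is at most the logarithm plus 1 and the logarithm
      is at least 1, the factor is at most \<open>268 + 96 + 96 = 460\<close> times the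
      logarithm.\<close>
    also have "\<dots> \<le> real (length qs) * (500 * log 2 (real ?m + 2))"
      using \<kappa>(2,3) by (intro mult_left_mono) linarith+
    finally show ?thesis by (simp add: algebra_simps)
  qed
  have out: "\<exists>out. run ?A N ?m s0 es out \<and> total_update_time es out = (\<Sum>x<length qs. T x) \<and>
      (\<forall>j u. j < length es \<longrightarrow> es ! j = Query u \<longrightarrow> fst (out ! j) \<le> 2 \<and>
          snd (out ! j) = encode_mate (mate (M (length (updates (take j es)))) u))"
    if "updates es = qs" "\<forall>u. Query u \<in> set es \<longrightarrow> u < n" for es
  proof -
    have settled: "\<exists>P K i. settled P K i (S h)" if "h \<le> length qs" for h using inv(2)[OF that] by blast
    have start: "s0\<lparr>reg := (reg s0)(0 := 0)\<rparr> = S 0" using init(3) inv(1)[of 0] by (simp add: fun_upd_idem)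
    have A: "update_prog ?A = update_com" "query_prog ?A = query_com" by (simp_all add: matching_algorithm_def)
    have "updates es = drop 0 qs" using that(1) by simp
    from run_exists[OF upd settled inv(1) A M_def le0 this that(2) start]
    show ?thesis by (simp only: atLeast0LessThan add_0)
  qed
  have "\<exists>out. run ?A N ?m s0 es out \<and>
      real (total_update_time es out) \<le> real 500 * real (length qs) * log 2 (real ?m + 2) \<and>
      (\<forall>j u. j < length es \<longrightarrow> es ! j = Query u \<longrightarrow> fst (out ! j) \<le> 500 \<and>
        snd (out ! j) = encode_mate (mate (M (length (updates (take j es)))) u))"
    if es: "updates es = qs" "\<forall>u. Query u \<in> set es \<longrightarrow> u < n" for es
  proof -
    have "t \<le> 500" if "t \<le> 2" for t :: nat using that by simp
    then show ?thesis using out[OF es] cost by metis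
  qed
  moreover have "t0 \<le> 500 * setup_bound (alloc_model N) n" using init(2) by linarith
  moreover have "exec N (take ?m qs) (setup_prog ?A) (initial_state n) t0 s0"
    using init(1) by (simp add: matching_algorithm_def)
  ultimately show "\<exists>s\<^sub>0 t\<^sub>0. exec N (take ?m qs) (setup_prog ?A) (initial_state n) t\<^sub>0 s\<^sub>0 \<and>
      t\<^sub>0 \<le> 500 * setup_bound (alloc_model N) n \<and>
      (\<exists>M. (\<forall>i\<le>length qs. maximal_matching (graph_after qs i) (M i)) \<and>
        (\<forall>es. updates es = qs \<longrightarrow> (\<forall>u. Query u \<in> set es \<longrightarrow> u < n) \<longrightarrow>
          (\<exists>out. run ?A N ?m s\<^sub>0 es out \<and>
            real (total_update_time es out) \<le> real 500 * real (length qs) * log 2 (real ?m + 2) \<and>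
            (\<forall>j u. j < length es \<longrightarrow> es ! j = Query u \<longrightarrow> fst (out ! j) \<le> 500 \<and>
              snd (out ! j) = encode_mate (mate (M (length (updates (take j es)))) u)))))"
    using max by blast
qed

end
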